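(* Let $\varepsilon>0$ and let $h<-2\sqrt{\varepsilon}$ be an energy value below the critical value of the planar Stark Hamiltonian $H_\varepsilon$. Then the bounded component $\overline{\Sigma}^b_{\varepsilon,h}\subset T^*\mathbb{C}=\mathbb{R}^4$ of the Levi-Civita regularized energy hypersurface of energy $h$ arises as the boundary of a concave toric domain. That is, there exist a concave toric domain $X_\Omega\subset\mathbb{C}^2$ and a symplectomorphism from an open neighbourhood of $\overline{\Sigma}^b_{\varepsilon,h}$ in $T^*\mathbb{C}$ onto an open neighbourhood of $\partial X_\Omega$ in $\mathbb{C}^2$ which maps $\overline{\Sigma}^b_{\varepsilon,h}$ onto $\partial X_\Omega$.
   Context: **Stark problem.** For field strength $\varepsilon>0$ the planar Stark Hamiltonian is $H_\varepsilon\colon T^*(\mathbb{R}^2\setminus\{0\})\to\mathbb{R}$, $H_\varepsilon(q,p)=\frac{|p|^2}{2}-\frac{1}{|q|}+\varepsilon q_1$, with symplectic form $\omega=dp_1\wedge dq_1+dp_2\wedge dq_2$. It has a unique critical point, with critical value $-2\sqrt{\varepsilon}$. **Regularization.** Identify $\mathbb{R}^2$ with $\mathbb{C}$. The Levi-Civita map $\ell(z)=z^2/2$ on $\mathbb{C}\setminus\{0\}$ lifts to the two-to-one symplectic covering $L\colon T^*(\mathbb{C}\setminus\{0\})\to T^*(\mathbb{C}\setminus\{0\})$, $L(z,w)=\left(\frac{z^2}{2},\frac{w}{\overline z}\right)$. For energy $h$, the function $|z|^2\,(H_\varepsilon\circ L(z,w)-h)$ extends smoothly to $T^*\mathbb{C}=\mathbb{R}^4$,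 with coordinates $z=z_1+iz_2$, $w=w_1+iw_2$, as $$E_{\varepsilon,h}(z,w)=\Big(\tfrac12 w_1^2-h z_1^2+\tfrac{\varepsilon}{2}z_1^4\Big)+\Big(\tfrac12 w_2^2-h z_2^2-\tfrac{\varepsilon}{2}z_2^4\Big)-2 .$$ The regularized energy hypersurface is $\overline{\Sigma}_{\varepsilon,h}=E_{\varepsilon,h}^{-1}(0)\subset T^*\mathbb{C}$. For $h<-2\sqrt{\varepsilon}$ it has exactly one bounded connected component, denoted $\overline{\Sigma}^b_{\varepsilon,h}$; this component is diffeomorphic to $S^3$. $T^*\mathbb{C}$ carries the standard symplectic form $dw_1\wedge dz_1+dw_2\wedge dz_2$. **Concave toric domain.** A concave toric domain is a set $$X_\Omega=\{(u_1,u_2)\in\mathbb{C}^2:(\pi|u_1|^2,\pi|u_2|^2)\in\Omega\},\qquad \Omega=\{(x,y):0\le x\le a,\ 0\le y\le f(x)\},$$ where $a,b>0$ and $f\colon[0,a]\to[0,b]$ is a convex, decreasing function with $f(0)=b$ and $f(a)=0$. Here $\mathbb{C}^2$ carries its standard symplectic form (with $u_j=x_j+iy_j$, the form $dy_1\wedge dx_1+dy_2\wedge dx_2$). The boundary $\partial X_\Omega$ is the topological boundary in $\mathbb{C}^2$, i.e. the set of points with $(\pi|u_1|^2,\pi|u_2|^2)$ on the graph of $f$. *)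

theory Defs
  imports "HOL-Analysis.Analysis"
begin

section \<open>Smooth maps and symplectomorphisms\<close>

primrec higher_differentiable_on ::
  "nat \<Rightarrow> 'a::real_normed_vector set \<Rightarrow> ('a \<Rightarrow> 'b::real_normed_vector) \<Rightarrow> bool" where
  "higher_differentiable_on 0 S f \<longleftrightarrow> continuous_on S f"
| "higher_differentiable_on (Suc n) S f \<longleftrightarrow>
     (\<forall>x\<in>S. f differentiable (at x)) \<and>
     (\<forall>v. higher_differentiable_on n S (\<lambda>x. frechet_derivative f (at x) v))"

text \<open>This is the usual notion of a $C^\infty$ map only if the set is open and the domain is
  finite-dimensional, as in every use below.\<close>

definition smooth_on ::
  "'a::real_normed_vector set \<Rightarrow> ('a \<Rightarrow> 'b::real_normed_vector) \<Rightarrow> bool" where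
  "smooth_on S f \<longleftrightarrow> (\<forall>n. higher_differentiable_on n S f)"

text \<open>A symplectic form enters as a constant bilinear form on a vector space.\<close>

definition symplectomorphism ::
  "('a::real_normed_vector \<Rightarrow> 'a \<Rightarrow> real) \<Rightarrow> 'a set \<Rightarrow>
   ('b::real_normed_vector \<Rightarrow> 'b \<Rightarrow> real) \<Rightarrow> 'b set \<Rightarrow> ('a \<Rightarrow> 'b) \<Rightarrow> bool" where
  "symplectomorphism \<omega> U \<omega>' V \<phi> \<longleftrightarrow>
     open U \<and> open V \<and> bij_betw \<phi> U V \<and>
     smooth_on U \<phi> \<and> smooth_on V (inv_into U \<phi>) \<and>
     (\<forall>x\<in>U. \<forall>v v'. \<omega>' (frechet_derivative \<phi> (at x) v) (frechet_derivative \<phi> (at x) v') = \<omega> v v')"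

text \<open>The form $dw_1\wedge dz_1+dw_2\wedge dz_2$ on $T^*\mathbb{C}$, whose points are pairs
  (position, momentum).\<close>

definition omega_cotangent :: "complex \<times> complex \<Rightarrow> complex \<times> complex \<Rightarrow> real" where
  "omega_cotangent = (\<lambda>(z, w) (z', w').
     (Re w * Re z' - Re z * Re w') + (Im w * Im z' - Im z * Im w'))"

text \<open>The form $dy_1\wedge dx_1+dy_2\wedge dx_2$ on $\mathbb{C}^2$, where $u_j=x_j+iy_j$: here each
  complex coordinate is itself a conjugate pair, unlike in the previous form.\<close>

definition omega_C2 :: "complex \<times> complex \<Rightarrow> complex \<times> complex \<Rightarrow> real" where
  "omega_C2 = (\<lambda>(u1, u2) (v1, v2).
     (Im u1 * Re v1 - Re u1 * Im v1) + (Im u2 * Re v2 - Re u2 * Im v2))"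


section \<open>The planar Stark problem and its Levi-Civita regularization\<close>

definition stark_hamiltonian :: "real \<Rightarrow> complex \<times> complex \<Rightarrow> real" where
  "stark_hamiltonian \<epsilon> = (\<lambda>(q, p). (cmod p)\<^sup>2 / 2 - 1 / cmod q + \<epsilon> * Re q)"

definition levi_civita :: "complex \<times> complex \<Rightarrow> complex \<times> complex" where
  "levi_civita = (\<lambda>(z, w). (z\<^sup>2 / 2, w / cnj z))"

definition regularized_energy :: "real \<Rightarrow> real \<Rightarrow> complex \<times> complex \<Rightarrow> real" where
  "regularized_energy \<epsilon> h = (\<lambda>(z, w).
     ((Re w)\<^sup>2 / 2 - h * (Re z)\<^sup>2 + \<epsilon> / 2 * (Re z) ^ 4) +
     ((Im w)\<^sup>2 / 2 - h * (Im z)\<^sup>2 - \<epsilon> / 2 * (Im z) ^ 4) - 2)"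

lemma regularized_energy_eq_levi_civita:
  assumes "z \<noteq> 0"
  shows "regularized_energy \<epsilon> h (z, w) =
    (cmod z)\<^sup>2 * (stark_hamiltonian \<epsilon> (levi_civita (z, w)) - h)"
proof -
  have n: "(cmod z)\<^sup>2 \<noteq> 0" using assms by simp
  have "(cmod z)\<^sup>2 * (stark_hamiltonian \<epsilon> (levi_civita (z, w)) - h) =
      (cmod w)\<^sup>2 / 2 - 2 + \<epsilon> / 2 * ((cmod z)\<^sup>2 * Re (z\<^sup>2)) - h * (cmod z)\<^sup>2"
    using n unfolding stark_hamiltonian_def levi_civita_def
    by (simp add: norm_divide norm_power power_divide field_simps)
  also have "\<dots> = regularized_energy \<epsilon> h (z, w)"
    unfolding regularized_energy_def cmod_power2
    by (simp add: algebra_simps power2_eq_square power4_eq_xxxx add_divide_distrib diff_divide_distrib)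
  finally show ?thesis by simp
qed

definition regularized_hypersurface :: "real \<Rightarrow> real \<Rightarrow> (complex \<times> complex) set" where
  "regularized_hypersurface \<epsilon> h = {x. regularized_energy \<epsilon> h x = 0}"

text \<open>The description is meaningful for $h<-2\sqrt\varepsilon$ with $\varepsilon>0$, where exactly one
  component is bounded.\<close>

definition bounded_component :: "real \<Rightarrow> real \<Rightarrow> (complex \<times> complex) set" where
  "bounded_component \<epsilon> h =
     (THE B. B \<in> components (regularized_hypersurface \<epsilon> h) \<and> bounded B)"


section \<open>Concave toric domains\<close>

definition toric_domain :: "(real \<times> real) set \<Rightarrow> (complex \<times> complex) set" where
  "toric_domain \<Omega> = {(u1, u2). (pi * (cmod u1)\<^sup>2, pi * (cmod u2)\<^sup>2) \<in> \<Omega>}"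

text \<open>Convexity and monotonicity alone would allow a jump of $f$ at $0$, and then the topological
  boundary of the domain would be larger than the preimage of the graph of $f$. Since the boundary
  of a concave toric domain is understood to be that preimage, continuity is part of the
  definition. ``Decreasing'' means strictly decreasing.\<close>

definition concave_toric_domain :: "(complex \<times> complex) set \<Rightarrow> bool" where
  "concave_toric_domain X \<longleftrightarrow> (\<exists>a b f.
     0 < a \<and> 0 < b \<and> f \<in> {0..a} \<rightarrow> {0..b} \<and>
     convex_on {0..a} f \<and> strict_antimono_on {0..a} f \<and> continuous_on {0..a} f \<and>
     f 0 = b \<and> f a = 0 \<and>
     X = toric_domain {(x, y). 0 \<le> x \<and> x \<le> a \<and> 0 \<le> y \<and> y \<le> f x})"

end

theory Submission
  imports Defs
begin


text \<open>Put $c=-h$. In the coordinate pairs $(z_1,w_1)$ and $(z_2,w_2)$ the regularized energy splits as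
  $E=H_1+H_2-2$ with $H_i=w_i^2/2+c z_i^2\pm\frac{\varepsilon}{2}z_i^4$, a hardening and a softening quartic
  well. The hypothesis says $4\varepsilon<c^2$, that is, the level $2$ lies below the height
  $c^2/(2\varepsilon)$ of the softening well, so on the bounded component both pairs stay inside their wells.

  Each well carries an area-preserving map onto a disc in the plane that makes its energy a function of
  the radius. Substituting $s=z\sqrt{2c+kz^2}$ (with $k=\pm\varepsilon$) gives $H=(s^2+w^2)/2$, at the price of
  turning the area form into $m(s)\,ds\,dw$, where $m=dz/ds$ is explicit and smooth for $|s|<c/\sqrt\varepsilon$
  (locale \<open>quartic_well\<close>). For any smooth positive density $m$ on a disc, the locale
  \<open>disc_density\<close> constructs a smooth map straightening $m(s)\,ds\,dw$ to the standard form and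
  carrying circles about the origin to circles about the origin: it rescales radii so that discs get the right area and twists each
  circle so that arcs get the right share. Both corrections are built from weighted averages of smooth functions
  over rotations, which makes smoothness at the centre evident.

  The product of the two maps is a symplectomorphism onto its open image
  (\<open>symplectomorphismI\<close>) and takes the bounded component to the set where the two actions are
  $A_1(e)$ and $A_2(2-e)$ with $0\le e\le 2$, the preimage of the graph of $f(A_1(e))=A_2(2-e)$. The derivative
  of the action is the period, and the two periods are one function: $A_1'(e)=T(\varepsilon e)$ and
  $A_2'(e)=T(-\varepsilon e)$. Hence $f'=-T(\varepsilon(e-2))/T(\varepsilon e)$, which increases with $e$ because
  $T$ is log-convex (\<open>period_mult_le\<close>): it is an integral of the functions
  $\sqrt{c+R}/(2R)$ with $R^2=c^2+2\sigma\cos^2 t$, each log-convex in $\sigma$. So $f$ is convex.\<close>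

section \<open>Calculus of smooth maps\<close>

lemma higher_differentiable_on_cong:
  assumes "open S" "\<And>x. x \<in> S \<Longrightarrow> f x = g x" "higher_differentiable_on n S f"
  shows "higher_differentiable_on n S g"
  using assms(2,3)
proof (induction n arbitrary: f g)
  case 0
  then show ?case using continuous_on_cong[of S S f g] by simp
next
  case (Suc n)
  have D: "(g has_derivative frechet_derivative f (at x)) (at x)" if "x \<in> S" for x
    by (rule has_derivative_transform_within_open[where f=f, OF _ assms(1) that])
      (use Suc.prems that in \<open>auto simp: frechet_derivative_works[symmetric]\<close>)
  have "higher_differentiable_on n S (\<lambda>x. frechet_derivative g (at x) v)" for v
  proof (rule Suc.IH)
    show "higher_differentiable_on n S (\<lambda>x. frechet_derivative f (at x) v)"
      using Suc.prems(2) by simp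
    show "frechet_derivative f (at x) v = frechet_derivative g (at x) v" if "x \<in> S" for x
      using frechet_derivative_at[OF D[OF that]] by simp
  qed
  moreover have "g differentiable (at x)" if "x \<in> S" for x
    using D[OF that] by (auto simp: differentiable_def)
  ultimately show ?case by simp
qed

lemma higher_differentiable_on_SucI:
  assumes "open S" "\<And>x. x \<in> S \<Longrightarrow> (f has_derivative f' x) (at x)"
    "\<And>v. higher_differentiable_on n S (\<lambda>x. f' x v)"
  shows "higher_differentiable_on (Suc n) S f"
proof -
  have "higher_differentiable_on n S (\<lambda>x. frechet_derivative f (at x) v)" for v
    by (rule higher_differentiable_on_cong[OF assms(1) _ assms(3)[of v]])
      (use frechet_derivative_at[OF assms(2)] in metis)
  then show ?thesis using assms(2) by (auto simp: differentiable_def)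
qed

lemma higher_differentiable_on_SucD:
  assumes "higher_differentiable_on (Suc n) S f"
  shows "higher_differentiable_on n S f"
  using assms
proof (induction n arbitrary: f)
  case 0
  then show ?case
    by (auto intro!: differentiable_imp_continuous_on differentiable_at_imp_differentiable_on)
next
  case (Suc n)
  then show ?case by (metis higher_differentiable_on.simps(2))
qed

lemma higher_differentiable_on_const: "higher_differentiable_on n S (\<lambda>x. c)"
  by (induction n arbitrary: c) auto

lemma higher_differentiable_on_bounded_linear_compose:
  assumes "open S" "bounded_linear L" "higher_differentiable_on n S f"
  shows "higher_differentiable_on n S (\<lambda>x. L (f x))"
  using assms(3)
proof (induction n arbitrary: f)
  case 0
  then show ?case using bounded_linear.continuous_on[OF assms(2)] by simp
next
  case (Suc n)
  show ?case
  proof (rule higher_differentiable_on_SucI[OF assms(1)])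
    show "((\<lambda>x. L (f x)) has_derivative (\<lambda>v. L (frechet_derivative f (at x) v))) (at x)"
      if "x \<in> S" for x
      using Suc.prems that
      by (intro bounded_linear.has_derivative[OF assms(2)])
        (auto simp: frechet_derivative_works[symmetric])
    show "higher_differentiable_on n S (\<lambda>x. L (frechet_derivative f (at x) v))" for v
      using Suc by simp
  qed
qed

lemma higher_differentiable_on_bounded_linear:
  assumes "open S" "bounded_linear L"
  shows "higher_differentiable_on n S L"
proof (cases n)
  case 0
  then show ?thesis using assms(2) by (simp add: linear_continuous_on)
next
  case (Suc m)
  show ?thesis unfolding Suc
    by (rule higher_differentiable_on_SucI[OF assms(1) bounded_linear_imp_has_derivative[OF assms(2)]
          higher_differentiable_on_const])
qed

lemma higher_differentiable_on_add:
  assumes "open S" "higher_differentiable_on n S f" "higher_differentiable_on n S g"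
  shows "higher_differentiable_on n S (\<lambda>x. f x + g x)"
  using assms(2,3)
proof (induction n arbitrary: f g)
  case 0
  then show ?case by (auto intro: continuous_intros)
next
  case (Suc n)
  show ?case
  proof (rule higher_differentiable_on_SucI[OF assms(1)])
    show "((\<lambda>x. f x + g x) has_derivative
        (\<lambda>v. frechet_derivative f (at x) v + frechet_derivative g (at x) v)) (at x)"
      if "x \<in> S" for x
      using Suc.prems that
      by (intro has_derivative_add) (auto simp: frechet_derivative_works[symmetric])
    show "higher_differentiable_on n S
        (\<lambda>x. frechet_derivative f (at x) v + frechet_derivative g (at x) v)" for v
      using Suc by simp
  qed
qed

lemma higher_differentiable_on_sum:
  assumes "open S" "finite I" "\<And>i. i \<in> I \<Longrightarrow> higher_differentiable_on n S (f i)"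
  shows "higher_differentiable_on n S (\<lambda>x. \<Sum>i\<in>I. f i x)"
  using assms(2,3)
  by (induction I rule: finite_induct)
    (auto intro: higher_differentiable_on_add[OF assms(1)] higher_differentiable_on_const)

lemma (in bounded_bilinear) higher_differentiable_on_prod:
  assumes "open S" "higher_differentiable_on n S f" "higher_differentiable_on n S g"
  shows "higher_differentiable_on n S (\<lambda>x. prod (f x) (g x))"
  using assms(2,3)
proof (induction n arbitrary: f g)
  case 0
  then show ?case by (auto intro: continuous_on)
next
  case (Suc n)
  show ?case
  proof (rule higher_differentiable_on_SucI[OF assms(1)])
    show "((\<lambda>x. prod (f x) (g x)) has_derivative
        (\<lambda>v. prod (f x) (frechet_derivative g (at x) v) + prod (frechet_derivative f (at x) v) (g x))) (at x)"
      if "x \<in> S" for x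
      using Suc.prems that
      by (intro FDERIV) (auto simp: frechet_derivative_works[symmetric])
    show "higher_differentiable_on n S (\<lambda>x. prod (f x) (frechet_derivative g (at x) v)
        + prod (frechet_derivative f (at x) v) (g x))" for v
      using Suc.prems higher_differentiable_on_SucD[OF Suc.prems(1)]
        higher_differentiable_on_SucD[OF Suc.prems(2)]
      by (auto intro!: higher_differentiable_on_add[OF assms(1)] Suc.IH)
  qed
qed

text \<open>By the chain rule the derivative of the composite in a fixed direction expands, over a basis of the
  middle space, into products of directional derivatives of order one less; finite dimension of that space is
  used here.\<close>

lemma higher_differentiable_on_compose:
  fixes f :: "'a::real_normed_vector \<Rightarrow> 'b::euclidean_space" and g :: "'b \<Rightarrow> 'c::real_normed_vector"
  assumes "open S" "open T" "f ` S \<subseteq> T" "higher_differentiable_on n S f" "higher_differentiable_on n T g"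
  shows "higher_differentiable_on n S (\<lambda>x. g (f x))"
  using assms(4,5)
proof (induction n arbitrary: g)
  case 0
  then show ?case using assms(3) by (auto intro: continuous_on_compose2)
next
  case (Suc n)
  let ?D = "\<lambda>x v. \<Sum>b\<in>Basis. (frechet_derivative f (at x) v \<bullet> b) *\<^sub>R frechet_derivative g (at (f x)) b"
  have "((\<lambda>x. g (f x)) has_derivative ?D x) (at x)" if x: "x \<in> S" for x
  proof -
    have f: "(f has_derivative frechet_derivative f (at x)) (at x)"
      using Suc.prems x by (simp add: frechet_derivative_works[symmetric])
    have g: "(g has_derivative frechet_derivative g (at (f x))) (at (f x))"
      using Suc.prems x assms(3) by (auto simp: frechet_derivative_works[symmetric])
    have expand: "frechet_derivative g (at (f x)) w = (\<Sum>b\<in>Basis. (w \<bullet> b) *\<^sub>R frechet_derivative g (at (f x)) b)" for w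
    proof -
      interpret linear "frechet_derivative g (at (f x))"
        using g has_derivative_linear by blast
      show ?thesis by (subst euclidean_representation[of w, symmetric]) (simp add: sum scaleR)
    qed
    show ?thesis
      by (rule has_derivative_eq_rhs[OF has_derivative_compose[OF f g]]) (rule ext, rule expand)
  qed
  moreover have "higher_differentiable_on n S (\<lambda>x. ?D x v)" for v
  proof (intro higher_differentiable_on_sum[OF assms(1)]
      bounded_bilinear.higher_differentiable_on_prod[OF bounded_bilinear_scaleR assms(1)])
    show "higher_differentiable_on n S (\<lambda>x. frechet_derivative f (at x) v \<bullet> b)" for b
      using Suc.prems
      by (intro higher_differentiable_on_bounded_linear_compose[OF assms(1) bounded_linear_inner_left]) simp
    show "higher_differentiable_on n S (\<lambda>x. frechet_derivative g (at (f x)) b)" for b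
      using Suc.prems higher_differentiable_on_SucD by (intro Suc.IH) auto
  qed simp
  ultimately show ?case by (rule higher_differentiable_on_SucI[OF assms(1)])
qed

lemma smooth_on_cong:
  assumes "open S" "\<And>x. x \<in> S \<Longrightarrow> f x = g x" "smooth_on S f"
  shows "smooth_on S g"
  using assms higher_differentiable_on_cong unfolding smooth_on_def by blast

lemma smooth_on_imp_continuous_on: "smooth_on S f \<Longrightarrow> continuous_on S f"
  using higher_differentiable_on.simps(1) smooth_on_def by blast

lemma smooth_on_has_derivative:
  assumes "smooth_on S f" "x \<in> S"
  shows "(f has_derivative frechet_derivative f (at x)) (at x)"
  using assms unfolding smooth_on_def frechet_derivative_works[symmetric]
  by (metis higher_differentiable_on.simps(2))

lemma smooth_on_frechet_derivative:
  "smooth_on S f \<Longrightarrow> smooth_on S (\<lambda>x. frechet_derivative f (at x) v)"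
  unfolding smooth_on_def by (metis higher_differentiable_on.simps(2))

lemma smooth_on_const: "smooth_on S (\<lambda>x. c)"
  by (simp add: smooth_on_def higher_differentiable_on_const)

lemma smooth_on_bounded_linear_compose:
  "open S \<Longrightarrow> bounded_linear L \<Longrightarrow> smooth_on S f \<Longrightarrow> smooth_on S (\<lambda>x. L (f x))"
  by (simp add: smooth_on_def higher_differentiable_on_bounded_linear_compose)

lemma smooth_on_bounded_linear: "open S \<Longrightarrow> bounded_linear L \<Longrightarrow> smooth_on S L"
  by (simp add: smooth_on_def higher_differentiable_on_bounded_linear)

lemma smooth_on_add:
  "open S \<Longrightarrow> smooth_on S f \<Longrightarrow> smooth_on S g \<Longrightarrow> smooth_on S (\<lambda>x. f x + g x)"
  by (simp add: smooth_on_def higher_differentiable_on_add)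

lemma (in bounded_bilinear) smooth_on_prod:
  "open S \<Longrightarrow> smooth_on S f \<Longrightarrow> smooth_on S g \<Longrightarrow> smooth_on S (\<lambda>x. prod (f x) (g x))"
  by (simp add: smooth_on_def higher_differentiable_on_prod)

lemmas smooth_on_mult = bounded_bilinear.smooth_on_prod[OF bounded_bilinear_mult]
lemmas smooth_on_scaleR = bounded_bilinear.smooth_on_prod[OF bounded_bilinear_scaleR]

lemma smooth_on_Pair:
  assumes "open S" "smooth_on S f" "smooth_on S g"
  shows "smooth_on S (\<lambda>x. (f x, g x))"
proof -
  have "smooth_on S (\<lambda>x. (f x, 0) + (0, g x))"
    by (intro smooth_on_add smooth_on_bounded_linear_compose[of S "\<lambda>y. (y, 0)"]
        smooth_on_bounded_linear_compose[of S "\<lambda>y. (0, y)"] assms bounded_linear_intros)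
  then show ?thesis by simp
qed

lemma smooth_on_compose:
  fixes f :: "'a::real_normed_vector \<Rightarrow> 'b::euclidean_space"
  shows "smooth_on T g \<Longrightarrow> smooth_on S f \<Longrightarrow> f ` S \<subseteq> T \<Longrightarrow> open S \<Longrightarrow> open T \<Longrightarrow>
    smooth_on S (\<lambda>x. g (f x))"
  by (simp add: smooth_on_def higher_differentiable_on_compose)

lemma smooth_on_inverse_real: "smooth_on (- {0}) (inverse :: real \<Rightarrow> real)"
proof -
  have "higher_differentiable_on n (- {0}) (inverse :: real \<Rightarrow> real)" for n
  proof (induction n)
    case 0
    then show ?case by (auto intro!: continuous_intros)
  next
    case (Suc n)
    show ?case
    proof (rule higher_differentiable_on_SucI)
      show "(inverse has_derivative (\<lambda>v. - (inverse x * v * inverse x))) (at x)"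
        if "x \<in> - {0}" for x :: real
        using that has_derivative_inverse'[of x UNIV] by simp
      have "higher_differentiable_on n (- {0}) (\<lambda>x. (- v) * (inverse x * inverse x))" for v :: real
        by (intro bounded_bilinear.higher_differentiable_on_prod[OF bounded_bilinear_mult]
            higher_differentiable_on_const Suc open_Compl) auto
      then show "higher_differentiable_on n (- {0}) (\<lambda>x. - (inverse x * v * inverse x))" for v :: real
        by (simp add: mult_ac)
    qed auto
  qed
  then show ?thesis by (simp add: smooth_on_def)
qed

lemma smooth_on_sqrt: "smooth_on {0<..} sqrt"
proof -
  have "higher_differentiable_on n {0<..} sqrt" for n
  proof (induction n)
    case 0
    then show ?case by (auto intro!: continuous_intros)
  next
    case (Suc n)
    show ?case
    proof (rule higher_differentiable_on_SucI)
      show "(sqrt has_derivative (\<lambda>v. inverse (sqrt x) * (v / 2))) (at x)"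
        if "x \<in> {0<..}" for x
        using that DERIV_real_sqrt[of x] unfolding has_field_derivative_def
        by (auto elim!: has_derivative_eq_rhs simp: field_simps)
      show "higher_differentiable_on n {0<..} (\<lambda>x. inverse (sqrt x) * (v / 2))" for v :: real
        using smooth_on_inverse_real
        by (intro bounded_bilinear.higher_differentiable_on_prod[OF bounded_bilinear_mult]
            higher_differentiable_on_const higher_differentiable_on_compose[where T="- {0}" and f=sqrt, OF _ _ _ Suc])
          (auto simp: smooth_on_def)
    qed auto
  qed
  then show ?thesis by (simp add: smooth_on_def)
qed

lemma smooth_on_cis: "smooth_on UNIV cis"
proof -
  have "higher_differentiable_on n UNIV cis" for n
  proof (induction n)
    case 0
    then show ?case by (auto intro!: continuous_intros)
  next
    case (Suc n)
    show ?case
    proof (rule higher_differentiable_on_SucI)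
      show "(cis has_derivative (\<lambda>v. (v *\<^sub>R \<i>) * cis x)) (at x)" for x
        using has_derivative_cis[of "\<lambda>x. x" "\<lambda>x. x" x UNIV]
        by (simp add: mult_ac)
      show "higher_differentiable_on n UNIV (\<lambda>x. (v *\<^sub>R \<i>) * cis x)" for v
        by (intro bounded_bilinear.higher_differentiable_on_prod[OF bounded_bilinear_mult]
            higher_differentiable_on_const Suc) auto
    qed auto
  qed
  then show ?thesis by (simp add: smooth_on_def)
qed

lemma smooth_on_divide:
  assumes "open S" "smooth_on S f" "smooth_on S g" "\<And>x. x \<in> S \<Longrightarrow> g x \<noteq> (0::real)"
  shows "smooth_on S (\<lambda>x. f x / g x)"
proof -
  have "smooth_on S (\<lambda>x. f x * inverse (g x))"
    by (intro smooth_on_mult smooth_on_compose[OF smooth_on_inverse_real] assms) (use assms(4) in auto)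
  then show ?thesis by (simp add: divide_inverse)
qed

lemma smooth_on_sqrt_compose:
  assumes "open S" "smooth_on S f" "\<And>x. x \<in> S \<Longrightarrow> f x > 0"
  shows "smooth_on S (\<lambda>x. sqrt (f x))"
  by (intro smooth_on_compose[OF smooth_on_sqrt] assms) (use assms(3) in auto)

lemma smooth_on_power:
  fixes f :: "'a::real_normed_vector \<Rightarrow> real"
  shows "open S \<Longrightarrow> smooth_on S f \<Longrightarrow> smooth_on S (\<lambda>x. f x ^ n)"
  by (induction n) (auto intro: smooth_on_const smooth_on_mult)

lemma smooth_on_deriv:
  fixes g :: "real \<Rightarrow> real"
  assumes "open J" "smooth_on J g"
  shows "smooth_on J (deriv g)"
    and "x \<in> J \<Longrightarrow> (g has_real_derivative deriv g x) (at x)"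
proof -
  have D: "(g has_real_derivative frechet_derivative g (at x) 1) (at x)" if "x \<in> J" for x
  proof -
    have *: "(g has_derivative frechet_derivative g (at x)) (at x)"
      by (rule smooth_on_has_derivative[OF assms(2) that])
    then obtain c where "frechet_derivative g (at x) = (\<lambda>v. v * c)"
      using has_derivative_bounded_linear real_bounded_linear by blast
    then show ?thesis
      using * by (simp add: has_field_derivative_def mult_commute_abs)
  qed
  show "smooth_on J (deriv g)"
    by (rule smooth_on_cong[OF assms(1) _ smooth_on_frechet_derivative[OF assms(2), of 1]])
      (simp add: DERIV_imp_deriv[OF D])
  show "x \<in> J \<Longrightarrow> (g has_real_derivative deriv g x) (at x)"
    using D DERIV_imp_deriv by metis
qed


section \<open>Integrals depending on a parameter\<close>

lemma continuous_on_param_integrand: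
  fixes g a :: "real \<Rightarrow> real" and p :: "real \<Rightarrow> 'a::euclidean_space"
  assumes "continuous_on J g" "continuous_on {\<alpha>..\<beta>} a" "continuous_on {\<alpha>..\<beta>} p"
    and "\<And>t. t \<in> {\<alpha>..\<beta>} \<Longrightarrow> x \<bullet> p t \<in> J"
  shows "continuous_on {\<alpha>..\<beta>} (\<lambda>t. a t * g (x \<bullet> p t))"
  by (intro continuous_intros assms continuous_on_compose2[OF assms(1)]) (use assms(4) in auto)

text \<open>The integrand depends on the parameter only through the scalar $x\cdot p(t)$, so a directional
  derivative of the integral is an integral of the same shape, with a new weight and with the derivative of
  $g$. The smoothness lemma below iterates this.\<close>

lemma has_derivative_param_integral:
  fixes g a :: "real \<Rightarrow> real" and p :: "real \<Rightarrow> 'a::euclidean_space"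
  assumes J: "open J" "smooth_on J g"
    and a: "continuous_on {\<alpha>..\<beta>} a" and p: "continuous_on {\<alpha>..\<beta>} p"
    and S: "open S" "convex S" "\<And>x t. x \<in> S \<Longrightarrow> t \<in> {\<alpha>..\<beta>} \<Longrightarrow> x \<bullet> p t \<in> J"
    and x: "x \<in> S"
  shows "((\<lambda>x. integral {\<alpha>..\<beta>} (\<lambda>t. a t * g (x \<bullet> p t))) has_derivative
    (\<lambda>v. integral {\<alpha>..\<beta>} (\<lambda>t. a t * (v \<bullet> p t) * deriv g (x \<bullet> p t)))) (at x)"
proof -
  define F where "F = (\<lambda>x t. (a t * deriv g (x \<bullet> p t)) *\<^sub>R blinfun_inner_left (p t))"
  have g': "continuous_on J (deriv g)"
    by (intro smooth_on_imp_continuous_on smooth_on_deriv J)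
  have FD: "((\<lambda>x. a t * g (x \<bullet> p t)) has_derivative blinfun_apply (F x t)) (at x within S)"
    if "x \<in> S" "t \<in> cbox \<alpha> \<beta>" for x t
  proof -
    have *: "(g has_derivative (\<lambda>h. deriv g (x \<bullet> p t) * h)) (at (x \<bullet> p t))"
      using smooth_on_deriv(2)[OF J] S(3)[of x t] that by (simp add: has_field_derivative_def)
    have "((\<lambda>x. a t * g (x \<bullet> p t)) has_derivative (\<lambda>v. a t * (deriv g (x \<bullet> p t) * (v \<bullet> p t)))) (at x)"
      by (intro has_derivative_mult_right has_derivative_compose[of "\<lambda>x. x \<bullet> p t" "\<lambda>v. v \<bullet> p t" x UNIV, OF _ *]
          bounded_linear_imp_has_derivative bounded_linear_inner_left)
    then show ?thesis
      by (rule has_derivative_at_withinI[OF has_derivative_eq_rhs])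
        (auto simp: F_def blinfun.scaleR_left)
  qed
  have Fc: "continuous_on (S \<times> cbox \<alpha> \<beta>) (\<lambda>(x, t). F x t)"
    unfolding F_def split_beta
    by (intro continuous_intros bounded_linear.continuous_on[OF bounded_linear_blinfun_inner_left]
        continuous_on_compose2[OF a, of _ snd] continuous_on_compose2[OF p, of _ snd]
        continuous_on_compose2[OF g'])
      (use S(3) in auto)
  have int: "(\<lambda>t. a t * g (x \<bullet> p t)) integrable_on cbox \<alpha> \<beta>" if "x \<in> S" for x
    using integrable_continuous_real[OF continuous_on_param_integrand[OF
          smooth_on_imp_continuous_on[OF J(2)] a p S(3)[OF that]]] by simp
  have "((\<lambda>x. integral (cbox \<alpha> \<beta>) (\<lambda>t. a t * g (x \<bullet> p t))) has_derivative
      blinfun_apply (integral (cbox \<alpha> \<beta>) (F x))) (at x within S)"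
    by (rule leibniz_rule[OF FD int Fc x S(2)])
  moreover have "blinfun_apply (integral (cbox \<alpha> \<beta>) (F x)) v
      = integral {\<alpha>..\<beta>} (\<lambda>t. a t * (v \<bullet> p t) * deriv g (x \<bullet> p t))" for v
  proof -
    have "F x integrable_on cbox \<alpha> \<beta>"
      by (rule integrable_continuous, rule continuous_on_compose2[OF Fc, of _ "Pair x", simplified])
        (use x in \<open>auto intro!: continuous_intros\<close>)
    from blinfun_apply_integral[OF this] show ?thesis
      by (simp add: F_def blinfun.scaleR_left mult_ac)
  qed
  ultimately show ?thesis
    using at_within_open[OF x S(1)] has_derivative_eq_rhs by (metis (no_types, lifting) ext cbox_interval)
qed

lemma smooth_on_param_integral:
  fixes g a :: "real \<Rightarrow> real" and p :: "real \<Rightarrow> 'a::euclidean_space"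
  assumes J: "open J" "smooth_on J g"
    and a: "continuous_on {\<alpha>..\<beta>} a" and p: "continuous_on {\<alpha>..\<beta>} p"
    and S: "open S" "convex S" "\<And>x t. x \<in> S \<Longrightarrow> t \<in> {\<alpha>..\<beta>} \<Longrightarrow> x \<bullet> p t \<in> J"
  shows "smooth_on S (\<lambda>x. integral {\<alpha>..\<beta>} (\<lambda>t. a t * g (x \<bullet> p t)))"
  unfolding smooth_on_def
proof
  fix n
  show "higher_differentiable_on n S (\<lambda>x. integral {\<alpha>..\<beta>} (\<lambda>t. a t * g (x \<bullet> p t)))"
    using J(2) a
  proof (induction n arbitrary: g a)
    case 0
    then show ?case
      by (auto intro!: has_derivative_continuous_on
          has_derivative_at_withinI[OF has_derivative_param_integral[OF J(1) _ _ p S]])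
  next
    case (Suc n)
    show ?case
    proof (rule higher_differentiable_on_SucI[OF S(1)])
      show "((\<lambda>x. integral {\<alpha>..\<beta>} (\<lambda>t. a t * g (x \<bullet> p t))) has_derivative
          (\<lambda>v. integral {\<alpha>..\<beta>} (\<lambda>t. a t * (v \<bullet> p t) * deriv g (x \<bullet> p t)))) (at x)"
        if "x \<in> S" for x
        by (rule has_derivative_param_integral[OF J(1) Suc.prems p S that])
      show "higher_differentiable_on n S
          (\<lambda>x. integral {\<alpha>..\<beta>} (\<lambda>t. a t * (v \<bullet> p t) * deriv g (x \<bullet> p t)))" for v
        by (intro Suc.IH smooth_on_deriv[OF J(1)] Suc.prems continuous_intros p)
    qed
  qed
qed

section \<open>Area-preserving and symplectic maps\<close>

text \<open>The form $dy\wedge dx$ on the plane. On either of the two four-dimensional spaces the symplectic form is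
  a sum of two copies of it.\<close>

definition area_form :: "complex \<Rightarrow> complex \<Rightarrow> real" where
  "area_form a b = Im a * Re b - Re a * Im b"

lemma area_form_linear:
  assumes "linear D"
  shows "area_form (D v) (D v') = area_form (D \<i>) (D 1) * area_form v v'"
proof -
  have *: "D w = Re w *\<^sub>R D 1 + Im w *\<^sub>R D \<i>" for w
  proof -
    have "w = Re w *\<^sub>R 1 + Im w *\<^sub>R \<i>" by (simp add: complex_eq_iff)
    then show ?thesis using assms by (metis linear_add linear_cmul)
  qed
  show ?thesis
    unfolding *[of v] *[of v'] area_form_def by (simp add: algebra_simps)
qed

text \<open>The Jacobian determinant of a linear map of the plane can be read off any one pair of independent
  vectors.\<close>

lemma area_form_linear_eqI:
  assumes "linear D" "area_form (D a) (D b) = J * area_form a b" "area_form a b \<noteq> 0"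
  shows "area_form (D v) (D v') = J * area_form v v'"
  using area_form_linear[OF assms(1), of v v'] area_form_linear[OF assms(1), of a b] assms(2,3)
  by simp

lemma omega_cotangent_eq_area_form:
  "omega_cotangent (z, w) (z', w') =
    area_form (Complex (Re z) (Re w)) (Complex (Re z') (Re w')) +
    area_form (Complex (Im z) (Im w)) (Complex (Im z') (Im w'))"
  by (simp add: omega_cotangent_def area_form_def)

lemma omega_C2_eq_area_form:
  "omega_C2 (u1, u2) (v1, v2) = area_form u1 v1 + area_form u2 v2"
  by (simp add: omega_C2_def area_form_def)

lemma bounded_linear_omega_C2:
  "bounded_linear (omega_C2 x)" "bounded_linear (\<lambda>x. omega_C2 x y)"
proof -
  have "linear (omega_C2 x)" "linear (\<lambda>x. omega_C2 x y)"
    by (auto intro!: linearI simp: omega_C2_def split_beta algebra_simps)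
  then show "bounded_linear (omega_C2 x)" "bounded_linear (\<lambda>x. omega_C2 x y)"
    by (simp_all add: linear_conv_bounded_linear)
qed

text \<open>Smoothness of the inverse comes for free: a symplectic matrix is inverted by transposing it
  with respect to the symplectic forms, so the derivative of the inverse depends linearly on the
  derivative of the map, taken at the preimage, and induction on the order applies.\<close>

lemma symplectomorphismI:
  assumes U: "open U" and inj: "inj_on \<phi> U" and sm: "smooth_on U \<phi>"
    and sy: "\<And>x v v'. x \<in> U \<Longrightarrow>
      omega_C2 (frechet_derivative \<phi> (at x) v) (frechet_derivative \<phi> (at x) v') = omega_cotangent v v'"
  shows "symplectomorphism omega_cotangent U omega_C2 (\<phi> ` U) \<phi>"
proof -
  define g where "g = inv_into U \<phi>"
  define G where "G = (\<lambda>y v.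
    (- omega_C2 v (frechet_derivative \<phi> (at (g y)) (0, 1))) *\<^sub>R (1, 0)
    + (- omega_C2 v (frechet_derivative \<phi> (at (g y)) (0, \<i>))) *\<^sub>R (\<i>, 0)
    + omega_C2 v (frechet_derivative \<phi> (at (g y)) (1, 0)) *\<^sub>R (0, 1)
    + omega_C2 v (frechet_derivative \<phi> (at (g y)) (\<i>, 0)) *\<^sub>R ((0, \<i>) :: complex \<times> complex))"
  have gf: "g (\<phi> x) = x" if "x \<in> U" for x
    using inj that by (simp add: g_def)
  have c\<phi>: "continuous_on U \<phi>" by (rule smooth_on_imp_continuous_on[OF sm])
  have V: "open (\<phi> ` U)" by (rule invariance_of_domain[OF c\<phi> U inj])
  have cg: "continuous_on (\<phi> ` U) g"
    by (rule continuous_on_inverse_open[OF U c\<phi> _ gf]) simp_all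
  have gV: "g ` \<phi> ` U \<subseteq> U" using gf by auto
  have D: "(g has_derivative G y) (at y)" if y: "y \<in> \<phi> ` U" for y
  proof -
    obtain x where x: "x \<in> U" "y = \<phi> x" using y by auto
    have "bounded_linear (G y)"
      unfolding G_def
      by (intro bounded_linear_add bounded_linear_minus bounded_linear_scaleR_const
          bounded_linear_omega_C2)
    moreover have "G y \<circ> frechet_derivative \<phi> (at x) = id"
    proof
      fix v :: "complex \<times> complex"
      obtain z w where v: "v = (z, w)" by (cases v)
      show "(G y \<circ> frechet_derivative \<phi> (at x)) v = id v"
        by (simp add: v G_def x gf sy[OF x(1)] omega_cotangent_def complex_eq_iff)
    qed
    ultimately show ?thesis
      unfolding x(2)
      using has_derivative_inverse_dieudonne[OF U V c\<phi> cg gf x(1) smooth_on_has_derivative[OF sm x(1)]]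
      by simp
  qed
  have "higher_differentiable_on n (\<phi> ` U) g" for n
  proof (induction n)
    case 0
    then show ?case using cg by simp
  next
    case (Suc n)
    have *: "higher_differentiable_on n (\<phi> ` U) (\<lambda>y. omega_C2 v (frechet_derivative \<phi> (at (g y)) e))" for v e
      by (rule higher_differentiable_on_bounded_linear_compose[OF V bounded_linear_omega_C2(1)],
          rule higher_differentiable_on_compose[OF V U gV Suc])
        (use smooth_on_frechet_derivative[OF sm] in \<open>simp add: smooth_on_def\<close>)
    have "higher_differentiable_on n (\<phi> ` U) (\<lambda>y. G y v)" for v
      unfolding G_def
      by (intro higher_differentiable_on_add[OF V] *
          bounded_bilinear.higher_differentiable_on_prod[OF bounded_bilinear_scaleR V]
          higher_differentiable_on_const
          higher_differentiable_on_bounded_linear_compose[OF V bounded_linear_minus[OF bounded_linear_ident]])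
    then show ?case by (intro higher_differentiable_on_SucI[OF V D])
  qed
  then have "smooth_on (\<phi> ` U) g" by (simp add: smooth_on_def)
  then show ?thesis
    using U V inj sm sy unfolding symplectomorphism_def g_def by (auto simp: inj_on_imp_bij_betw)
qed


section \<open>Straightening a density on a disc\<close>

text \<open>The integral over a full turn of $a(t)\,g(s(t))$, where $s(t)$ is the real part of the point rotated
  by the angle $-t$. For $a=1$ it is the mean of $g\circ\mathrm{Re}$ over the circle through the point, up to the
  factor $2\pi$.\<close>

definition circle_integral :: "(real \<Rightarrow> real) \<Rightarrow> (real \<Rightarrow> real) \<Rightarrow> complex \<Rightarrow> real" where
  "circle_integral a g \<zeta> = integral {0..2 * pi} (\<lambda>t. a t * g (\<zeta> \<bullet> cis t))"

lemma inner_cis_in_interval: "\<zeta> \<in> ball 0 \<rho> \<Longrightarrow> \<zeta> \<bullet> cis t \<in> {-\<rho><..<\<rho>}"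
  using Cauchy_Schwarz_ineq2[of \<zeta> "cis t"] by auto

lemma circle_integral_has_derivative:
  assumes "smooth_on {-\<rho><..<\<rho>} g" "continuous_on {0..2 * pi} a" "\<zeta> \<in> ball 0 \<rho>"
  shows "(circle_integral a g has_derivative
    (\<lambda>v. integral {0..2 * pi} (\<lambda>t. a t * (v \<bullet> cis t) * deriv g (\<zeta> \<bullet> cis t)))) (at \<zeta>)"
  unfolding circle_integral_def[abs_def]
  using inner_cis_in_interval
  by (intro has_derivative_param_integral[OF _ assms(1,2) _ _ _ _ assms(3)]) (auto intro: continuous_intros)

lemma smooth_on_circle_integral:
  assumes "smooth_on {-\<rho><..<\<rho>} g" "continuous_on {0..2 * pi} a"
  shows "smooth_on (ball 0 \<rho>) (circle_integral a g)"
  unfolding circle_integral_def[abs_def]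
  using inner_cis_in_interval
  by (intro smooth_on_param_integral[OF _ assms]) (auto intro: continuous_intros)

text \<open>Differentiating along the circle amounts to integrating by parts in the angle.\<close>

lemma circle_integral_angular_derivative:
  assumes g: "smooth_on {-\<rho><..<\<rho>} g" and \<zeta>: "\<zeta> \<in> ball 0 \<rho>"
    and a: "\<And>t. (a has_real_derivative a' t) (at t)" and ca': "continuous_on {0..2 * pi} a'"
  shows "integral {0..2 * pi} (\<lambda>t. a t * ((\<i> * \<zeta>) \<bullet> cis t) * deriv g (\<zeta> \<bullet> cis t))
    = circle_integral a' g \<zeta> - (a (2 * pi) - a 0) * g (Re \<zeta>)"
proof -
  let ?f = "\<lambda>t. a t * ((\<i> * \<zeta>) \<bullet> cis t) * deriv g (\<zeta> \<bullet> cis t)"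
  have ca: "continuous_on {0..2 * pi} a"
    using a DERIV_isCont by (blast intro: continuous_at_imp_continuous_on)
  have D: "((\<lambda>t. a t * g (\<zeta> \<bullet> cis t)) has_vector_derivative
      (a' t * g (\<zeta> \<bullet> cis t) - ?f t)) (at t within {0..2 * pi})" for t
  proof -
    have s: "((\<lambda>t. \<zeta> \<bullet> cis t) has_real_derivative - ((\<i> * \<zeta>) \<bullet> cis t)) (at t)"
      unfolding inner_complex_def by (auto intro!: derivative_eq_intros)
    have "((\<lambda>t. a t * g (\<zeta> \<bullet> cis t)) has_real_derivative
        (a' t * g (\<zeta> \<bullet> cis t) + deriv g (\<zeta> \<bullet> cis t) * - ((\<i> * \<zeta>) \<bullet> cis t) * a t)) (at t)"
      by (rule DERIV_mult[OF a DERIV_chain2[OF smooth_on_deriv(2)[OF _ g] s]])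
        (use inner_cis_in_interval[OF \<zeta>] in auto)
    then have "((\<lambda>t. a t * g (\<zeta> \<bullet> cis t)) has_real_derivative
        (a' t * g (\<zeta> \<bullet> cis t) - ?f t)) (at t)"
      by (rule DERIV_cong) (simp add: mult_ac)
    then show ?thesis
      unfolding has_real_derivative_iff_has_vector_derivative
      by (rule has_vector_derivative_at_within)
  qed
  have "((\<lambda>t. a' t * g (\<zeta> \<bullet> cis t) - ?f t) has_integral
      a (2 * pi) * g (\<zeta> \<bullet> cis (2 * pi)) - a 0 * g (\<zeta> \<bullet> cis 0)) {0..2 * pi}"
    by (rule fundamental_theorem_of_calculus[OF _ D]) simp
  moreover have "((\<lambda>t. a' t * g (\<zeta> \<bullet> cis t)) has_integral circle_integral a' g \<zeta>) {0..2 * pi}"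
    unfolding circle_integral_def
    by (intro integrable_integral integrable_continuous_real
        continuous_on_param_integrand[OF smooth_on_imp_continuous_on[OF g] ca'])
      (use inner_cis_in_interval[OF \<zeta>] in \<open>auto intro: continuous_intros\<close>)
  ultimately have "((\<lambda>t. a' t * g (\<zeta> \<bullet> cis t) - (a' t * g (\<zeta> \<bullet> cis t) - ?f t)) has_integral
      circle_integral a' g \<zeta> - (a (2 * pi) * g (\<zeta> \<bullet> cis (2 * pi)) - a 0 * g (\<zeta> \<bullet> cis 0))) {0..2 * pi}"
    by (rule has_integral_diff[rotated])
  then have "(?f has_integral circle_integral a' g \<zeta> - (a (2 * pi) - a 0) * g (Re \<zeta>)) {0..2 * pi}"
    by (simp add: algebra_simps inner_complex_def)
  then show ?thesis by (rule integral_unique)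
qed

lemma circle_integral_pos:
  assumes "continuous_on {-\<rho><..<\<rho>} g" "\<And>s. \<bar>s\<bar> < \<rho> \<Longrightarrow> 0 < g s" "\<zeta> \<in> ball 0 \<rho>"
  shows "0 < circle_integral (\<lambda>_. 1) g \<zeta>"
proof -
  have "integral {0..2 * pi} (\<lambda>t. 0) < integral {0..2 * pi} (\<lambda>t. 1 * g (\<zeta> \<bullet> cis t))"
  proof (rule integral_less_real)
    show "continuous_on {0..2 * pi} (\<lambda>t. 1 * g (\<zeta> \<bullet> cis t))"
      by (rule continuous_on_param_integrand[OF assms(1)])
        (use inner_cis_in_interval[OF assms(3)] in \<open>auto intro!: continuous_intros\<close>)
    show "0 < 1 * g (\<zeta> \<bullet> cis t)" for t
      using assms(2)[of "\<zeta> \<bullet> cis t"] inner_cis_in_interval[OF assms(3), of t]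
      by (simp add: abs_less_iff)
  qed (auto simp: not_le pi_gt_zero)
  then show ?thesis by (simp add: circle_integral_def)
qed

text \<open>The density on the disc of radius $\rho$ has the value $m(\mathrm{Re}\,\zeta)$ at $\zeta$; a density depending
  on one coordinate only is all that is needed.\<close>

locale disc_density =
  fixes \<rho> :: real and m :: "real \<Rightarrow> real"
  assumes rho_pos: "0 < \<rho>"
    and smooth_density: "smooth_on {-\<rho><..<\<rho>} m"
    and density_pos: "\<bar>s\<bar> < \<rho> \<Longrightarrow> 0 < m s"
begin

text \<open>The function $s\mapsto\int_0^1\tau\,m(s\tau)\,d\tau$: integrating it over a circle of radius $r$ and
  multiplying by $r^2$ gives the mass of the disc of radius $r$. The inner product is just the product of two
  reals.\<close>

definition radial_mean :: "real \<Rightarrow> real" where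
  "radial_mean s = integral {0..1} (\<lambda>\<tau>. \<tau> * m (s \<bullet> \<tau>))"

lemma radial_in_interval: "s \<in> {-\<rho><..<\<rho>} \<Longrightarrow> \<tau> \<in> {0..1} \<Longrightarrow> s \<bullet> \<tau> \<in> {-\<rho><..<\<rho>}"
proof -
  assume s: "s \<in> {-\<rho><..<\<rho>}" and t: "\<tau> \<in> {0..1}"
  have "\<bar>s * \<tau>\<bar> \<le> \<bar>s\<bar> * 1" unfolding abs_mult by (rule mult_left_mono) (use t in auto)
  then show ?thesis using s by (auto simp: abs_le_iff)
qed

lemma smooth_on_radial_mean: "smooth_on {-\<rho><..<\<rho>} radial_mean"
  unfolding radial_mean_def[abs_def]
  by (intro smooth_on_param_integral[OF _ smooth_density] radial_in_interval)
    (auto intro: continuous_intros)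

lemma radial_mean_pos:
  assumes "\<bar>s\<bar> < \<rho>"
  shows "0 < radial_mean s"
proof -
  have s: "s \<in> {-\<rho><..<\<rho>}" using assms by auto
  have "integral {0..1} (\<lambda>t::real. 0::real) < integral {0..1} (\<lambda>\<tau>. \<tau> * m (s \<bullet> \<tau>))"
  proof (rule integral_less_real)
    show "continuous_on {0..1} (\<lambda>\<tau>. \<tau> * m (s \<bullet> \<tau>))"
      by (rule continuous_on_param_integrand[OF smooth_on_imp_continuous_on[OF smooth_density]])
        (use radial_in_interval[OF s] in \<open>auto intro: continuous_intros\<close>)
    show "0 < \<tau> * m (s \<bullet> \<tau>)" if "\<tau> \<in> {0<..<1}" for \<tau>
      using density_pos[of "s \<bullet> \<tau>"] radial_in_interval[OF s, of \<tau>] that by (auto simp: abs_less_iff)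
  qed auto
  then show ?thesis by (simp add: radial_mean_def)
qed

text \<open>Both sides are $\int_0^1\frac{d}{d\tau}\bigl(\tau^2 m(s\tau)\bigr)\,d\tau$.\<close>

lemma radial_mean_euler:
  assumes "\<bar>s\<bar> < \<rho>"
  shows "s * deriv radial_mean s + 2 * radial_mean s = m s"
proof -
  have s: "s \<in> {-\<rho><..<\<rho>}" using assms by auto
  have c: "continuous_on {0..1} (\<lambda>\<tau>. a \<tau> * f (s \<bullet> \<tau>))"
    if "continuous_on {0..1} a" "smooth_on {-\<rho><..<\<rho>} f" for a f :: "real \<Rightarrow> real"
    by (rule continuous_on_param_integrand[OF smooth_on_imp_continuous_on[OF that(2)] that(1)])
      (use radial_in_interval[OF s] in \<open>auto intro: continuous_intros\<close>)
  have rm1: "(radial_mean has_derivative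
      (\<lambda>v. integral {0..1} (\<lambda>t. t * (v \<bullet> t) * deriv m (s \<bullet> t)))) (at s)"
    unfolding radial_mean_def[abs_def]
    by (rule has_derivative_param_integral[OF _ smooth_density _ _ _ _ _ s])
      (use radial_in_interval in \<open>auto intro: continuous_intros\<close>)
  have rm2: "(radial_mean has_derivative (\<lambda>v. v * deriv radial_mean s)) (at s)"
    using smooth_on_deriv(2)[OF _ smooth_on_radial_mean s] 
    by (simp add: has_field_derivative_def mult_commute_abs)
  have "integral {0..1} (\<lambda>t. t * (s \<bullet> t) * deriv m (s \<bullet> t)) = s * deriv radial_mean s"
    by (rule fun_cong[OF has_derivative_unique[OF rm1 rm2]])
  moreover have "(\<lambda>t. t * (s \<bullet> t) * deriv m (s \<bullet> t)) integrable_on {0..1}"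
    by (rule integrable_continuous_real,
        rule c[OF _ smooth_on_deriv(1)[OF open_greaterThanLessThan smooth_density]])
      (auto intro!: continuous_intros)
  ultimately have i1: "((\<lambda>t. t * (s \<bullet> t) * deriv m (s \<bullet> t)) has_integral s * deriv radial_mean s) {0..1}"
    using integrable_integral by metis
  have i2: "((\<lambda>\<tau>. \<tau> * m (s \<bullet> \<tau>)) has_integral radial_mean s) {0..1}"
    unfolding radial_mean_def
    by (intro integrable_integral integrable_continuous_real c smooth_density) (auto intro!: continuous_intros)
  have D: "((\<lambda>\<tau>. \<tau>\<^sup>2 * m (s \<bullet> \<tau>)) has_vector_derivative
      (\<tau> * (s \<bullet> \<tau>) * deriv m (s \<bullet> \<tau>) + 2 * (\<tau> * m (s \<bullet> \<tau>)))) (at \<tau> within {0..1})"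
    if "\<tau> \<in> {0..1}" for \<tau>
  proof -
    have "((\<lambda>\<tau>. s \<bullet> \<tau>) has_real_derivative s) (at \<tau>)" by (auto intro!: derivative_eq_intros)
    then have "((\<lambda>\<tau>. m (s \<bullet> \<tau>)) has_real_derivative deriv m (s \<bullet> \<tau>) * s) (at \<tau>)"
      by (rule DERIV_chain2[where g="(\<bullet>) s", OF smooth_on_deriv(2)[OF _ smooth_density], rotated 2])
        (use radial_in_interval[OF s that] in auto)
    then have "((\<lambda>\<tau>. \<tau>\<^sup>2 * m (s \<bullet> \<tau>)) has_real_derivative
        (\<tau> * (s \<bullet> \<tau>) * deriv m (s \<bullet> \<tau>) + 2 * (\<tau> * m (s \<bullet> \<tau>)))) (at \<tau>)"
      by (auto intro!: derivative_eq_intros simp: power2_eq_square)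
    then show ?thesis
      unfolding has_real_derivative_iff_has_vector_derivative
      by (rule has_vector_derivative_at_within)
  qed
  have "((\<lambda>\<tau>. \<tau> * (s \<bullet> \<tau>) * deriv m (s \<bullet> \<tau>) + 2 * (\<tau> * m (s \<bullet> \<tau>))) has_integral
      1\<^sup>2 * m (s \<bullet> 1) - 0\<^sup>2 * m (s \<bullet> 0)) {0..1}"
    by (rule fundamental_theorem_of_calculus[OF _ D]) simp_all
  from has_integral_unique[OF this has_integral_add[OF i1 has_integral_mult_right[OF i2, of 2]]]
  show ?thesis by simp
qed

text \<open>The integral of the density over the angle, on the circle through the given point.\<close>

definition circle_total :: "complex \<Rightarrow> real" where
  "circle_total = circle_integral (\<lambda>_. 1) m"

text \<open>The same integral weighted by the angle. Unlike the total it is not invariant under rotation; its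
  angular derivative compares the density at the point with the mean over the circle.\<close>

definition moment :: "complex \<Rightarrow> real" where
  "moment = circle_integral (\<lambda>t. t) m"

text \<open>The mass of the disc with the given point on its boundary, divided by the Euclidean area of
  that disc. Written as a circle integral it is smooth, and positive, also at the origin.\<close>

definition area_ratio :: "complex \<Rightarrow> real" where
  "area_ratio \<zeta> = circle_integral (\<lambda>_. 1) radial_mean \<zeta> / pi"

text \<open>The angle by which the straightening map turns the given point. Its angular derivative is
  the density divided by its mean over the circle, minus one.\<close>

definition twist :: "complex \<Rightarrow> real" where
  "twist \<zeta> = - moment \<zeta> / circle_total \<zeta>"

text \<open>The map that carries the density to the standard area form: scale by the square root of the area
  ratio and rotate by the twist.\<close>

definition straighten :: "complex \<Rightarrow> complex" where
  "straighten \<zeta> = sqrt (area_ratio \<zeta>) *\<^sub>R (cis (twist \<zeta>) * \<zeta>)"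

lemma circle_total_pos: "\<zeta> \<in> ball 0 \<rho> \<Longrightarrow> 0 < circle_total \<zeta>"
  unfolding circle_total_def
  by (rule circle_integral_pos[OF smooth_on_imp_continuous_on[OF smooth_density] density_pos])

lemma area_ratio_pos: "\<zeta> \<in> ball 0 \<rho> \<Longrightarrow> 0 < area_ratio \<zeta>"
  unfolding area_ratio_def
  using circle_integral_pos[OF smooth_on_imp_continuous_on[OF smooth_on_radial_mean] radial_mean_pos]
  by (simp add: pi_gt_zero)

lemma smooth_on_circle_total: "smooth_on (ball 0 \<rho>) circle_total"
  unfolding circle_total_def by (rule smooth_on_circle_integral[OF smooth_density]) auto

lemma smooth_on_area_ratio: "smooth_on (ball 0 \<rho>) area_ratio"
  unfolding area_ratio_def[abs_def]
  by (intro smooth_on_divide smooth_on_const smooth_on_circle_integral[OF smooth_on_radial_mean]) auto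

lemma smooth_on_twist: "smooth_on (ball 0 \<rho>) twist"
proof -
  have "smooth_on (ball 0 \<rho>) moment"
    unfolding moment_def by (rule smooth_on_circle_integral[OF smooth_density]) (auto intro: continuous_intros)
  then show ?thesis
    unfolding twist_def[abs_def]
    using circle_total_pos
    by (intro smooth_on_divide smooth_on_circle_total smooth_on_bounded_linear_compose[where L=uminus])
      (fastforce intro: bounded_linear_minus bounded_linear_ident)+
qed

lemma smooth_on_straighten: "smooth_on (ball 0 \<rho>) straighten"
  unfolding straighten_def[abs_def]
  by (intro smooth_on_scaleR smooth_on_mult smooth_on_sqrt_compose smooth_on_area_ratio
      smooth_on_compose[OF smooth_on_cis smooth_on_twist] smooth_on_bounded_linear bounded_linear_ident
      area_ratio_pos) auto

lemma circle_total_angular_derivative: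
  assumes "\<zeta> \<in> ball 0 \<rho>"
  obtains D where "(circle_total has_derivative D) (at \<zeta>)" "D (\<i> * \<zeta>) = 0"
proof
  show "(circle_total has_derivative
      (\<lambda>v. integral {0..2 * pi} (\<lambda>t. 1 * (v \<bullet> cis t) * deriv m (\<zeta> \<bullet> cis t)))) (at \<zeta>)"
    unfolding circle_total_def by (rule circle_integral_has_derivative[OF smooth_density _ assms]) auto
  show "integral {0..2 * pi} (\<lambda>t. 1 * ((\<i> * \<zeta>) \<bullet> cis t) * deriv m (\<zeta> \<bullet> cis t)) = 0"
    using circle_integral_angular_derivative[OF smooth_density assms, of "\<lambda>_. 1" "\<lambda>_. 0"]
    by (simp add: circle_integral_def)
qed

lemma area_ratio_derivative:
  assumes \<zeta>: "\<zeta> \<in> ball 0 \<rho>"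
  obtains D where "(area_ratio has_derivative D) (at \<zeta>)" "D (\<i> * \<zeta>) = 0"
    "D \<zeta> + 2 * area_ratio \<zeta> = circle_total \<zeta> / pi"
proof
  let ?D = "\<lambda>v. integral {0..2 * pi} (\<lambda>t. 1 * (v \<bullet> cis t) * deriv radial_mean (\<zeta> \<bullet> cis t))"
  note rm = smooth_on_radial_mean
  show "(area_ratio has_derivative (\<lambda>v. ?D v / pi)) (at \<zeta>)"
    unfolding area_ratio_def[abs_def]
    by (intro bounded_linear.has_derivative[OF bounded_linear_divide]
        circle_integral_has_derivative[OF rm _ \<zeta>]) auto
  show "?D (\<i> * \<zeta>) / pi = 0"
    using circle_integral_angular_derivative[OF rm \<zeta>, of "\<lambda>_. 1" "\<lambda>_. 0"]
    by (simp add: circle_integral_def)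
  have c: "(\<lambda>t. a t * f (\<zeta> \<bullet> cis t)) integrable_on {0..2 * pi}"
    if "continuous_on {0..2 * pi} a" "smooth_on {-\<rho><..<\<rho>} f" for a f :: "real \<Rightarrow> real"
    by (rule integrable_continuous_real,
        rule continuous_on_param_integrand[OF smooth_on_imp_continuous_on[OF that(2)] that(1)])
      (use inner_cis_in_interval[OF \<zeta>] in \<open>auto intro: continuous_intros\<close>)
  have c1: "(\<lambda>t. 1 * (\<zeta> \<bullet> cis t) * deriv radial_mean (\<zeta> \<bullet> cis t)) integrable_on {0..2 * pi}"
    by (rule c[OF _ smooth_on_deriv(1)[OF open_greaterThanLessThan rm]]) (intro continuous_intros)
  have c2: "(\<lambda>t. 2 * (1 * radial_mean (\<zeta> \<bullet> cis t))) integrable_on {0..2 * pi}"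
    using c[of "\<lambda>_. 2", OF _ rm] by simp
  have "?D \<zeta> + 2 * circle_integral (\<lambda>_. 1) radial_mean \<zeta> =
      integral {0..2 * pi} (\<lambda>t. 1 * (\<zeta> \<bullet> cis t) * deriv radial_mean (\<zeta> \<bullet> cis t)
        + 2 * (1 * radial_mean (\<zeta> \<bullet> cis t)))"
    unfolding circle_integral_def integral_add[OF c1 c2] by simp
  also have "\<dots> = circle_total \<zeta>"
    unfolding circle_total_def circle_integral_def
  proof (rule integral_cong)
    fix t
    show "1 * (\<zeta> \<bullet> cis t) * deriv radial_mean (\<zeta> \<bullet> cis t) + 2 * (1 * radial_mean (\<zeta> \<bullet> cis t))
        = 1 * m (\<zeta> \<bullet> cis t)"
      using radial_mean_euler[of "\<zeta> \<bullet> cis t"] inner_cis_in_interval[OF \<zeta>, of t] by (simp add: abs_less_iff)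
  qed
  finally have "(?D \<zeta> + 2 * circle_integral (\<lambda>_. 1) radial_mean \<zeta>) / pi = circle_total \<zeta> / pi"
    by simp
  then show "?D \<zeta> / pi + 2 * area_ratio \<zeta> = circle_total \<zeta> / pi"
    by (simp only: area_ratio_def add_divide_distrib times_divide_eq_right)
qed

lemma twist_derivative:
  assumes \<zeta>: "\<zeta> \<in> ball 0 \<rho>"
  obtains D where "(twist has_derivative D) (at \<zeta>)" "D (\<i> * \<zeta>) + 1 = 2 * pi * m (Re \<zeta>) / circle_total \<zeta>"
proof -
  obtain N where N: "(circle_total has_derivative N) (at \<zeta>)" "N (\<i> * \<zeta>) = 0"
    using circle_total_angular_derivative[OF \<zeta>] .
  define P where "P = (\<lambda>v. integral {0..2 * pi} (\<lambda>t. t * (v \<bullet> cis t) * deriv m (\<zeta> \<bullet> cis t)))"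
  have P: "(moment has_derivative P) (at \<zeta>)"
    unfolding moment_def P_def
    by (rule circle_integral_has_derivative[OF smooth_density _ \<zeta>]) (auto intro: continuous_intros)
  have Pi: "P (\<i> * \<zeta>) = circle_total \<zeta> - 2 * pi * m (Re \<zeta>)"
    using circle_integral_angular_derivative[OF smooth_density \<zeta>, of "\<lambda>t. t" "\<lambda>_. 1"]
    by (auto simp: P_def circle_total_def intro: derivative_intros)
  have pos: "circle_total \<zeta> > 0" by (rule circle_total_pos[OF \<zeta>])
  show thesis
  proof
    show "(twist has_derivative (\<lambda>v. (- P v * circle_total \<zeta> - - moment \<zeta> * N v) / (circle_total \<zeta> * circle_total \<zeta>))) (at \<zeta>)"
      unfolding twist_def[abs_def]
      using pos by (intro has_derivative_divide' has_derivative_minus P N(1)) auto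
    show "(- P (\<i> * \<zeta>) * circle_total \<zeta> - - moment \<zeta> * N (\<i> * \<zeta>)) / (circle_total \<zeta> * circle_total \<zeta>) + 1
        = 2 * pi * m (Re \<zeta>) / circle_total \<zeta>"
      using pos by (simp add: N(2) Pi field_simps)
  qed
qed

text \<open>Away from the origin the Jacobian is computed on the radial vector $\zeta$ and the angular vector
  $i\zeta$. With $B$ the area ratio, $N$ the total and $\chi$ the twist, it is
  $\bigl(\frac{1}{2}dB(\zeta)+B\bigr)\bigl(d\chi(i\zeta)+1\bigr)=\frac{N}{2\pi}\cdot\frac{2\pi m}{N}=m$.\<close>

lemma area_form_straighten:
  assumes \<zeta>: "\<zeta> \<in> ball 0 \<rho>" and D: "(straighten has_derivative D) (at \<zeta>)"
  shows "area_form (D v) (D v') = m (Re \<zeta>) * area_form v v'"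
proof -
  obtain B where B: "(area_ratio has_derivative B) (at \<zeta>)" "B (\<i> * \<zeta>) = 0"
    "B \<zeta> + 2 * area_ratio \<zeta> = circle_total \<zeta> / pi"
    using area_ratio_derivative[OF \<zeta>] .
  obtain X where X: "(twist has_derivative X) (at \<zeta>)"
    "X (\<i> * \<zeta>) + 1 = 2 * pi * m (Re \<zeta>) / circle_total \<zeta>"
    using twist_derivative[OF \<zeta>] .
  have Bp: "area_ratio \<zeta> > 0" and Np: "circle_total \<zeta> > 0" using \<zeta> area_ratio_pos circle_total_pos by auto
  define q where "q = sqrt (area_ratio \<zeta>)"
  have q: "q > 0" "q * q = area_ratio \<zeta>" using Bp by (auto simp: q_def)
  let ?D = "\<lambda>v. cis (twist \<zeta>) * (Complex (B v / (2 * q)) (q * X v) * \<zeta> + q *\<^sub>R v)"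
  have "(straighten has_derivative
      (\<lambda>v. q *\<^sub>R (cis (twist \<zeta>) * v + X v *\<^sub>R (\<i> * cis (twist \<zeta>)) * \<zeta>)
        + (B v / (2 * q)) *\<^sub>R (cis (twist \<zeta>) * \<zeta>))) (at \<zeta>)"
    unfolding straighten_def[abs_def]
    unfolding q_def
    using Bp
    by (auto intro!: derivative_eq_intros B(1) X(1) simp: field_simps)
  also have "(\<lambda>v. q *\<^sub>R (cis (twist \<zeta>) * v + X v *\<^sub>R (\<i> * cis (twist \<zeta>)) * \<zeta>)
        + (B v / (2 * q)) *\<^sub>R (cis (twist \<zeta>) * \<zeta>)) = ?D"
    by (auto simp: complex_eq_iff algebra_simps)
  finally have Deq: "D = ?D" using D has_derivative_unique by blast
  have lin: "linear D" using D has_derivative_linear by blast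
  have rot: "area_form (cis \<alpha> * a) (cis \<alpha> * b) = area_form a b" for \<alpha> a b
  proof -
    have "area_form (cis \<alpha> * a) (cis \<alpha> * b) = ((sin \<alpha>)\<^sup>2 + (cos \<alpha>)\<^sup>2) * area_form a b"
      unfolding area_form_def by (simp only: times_complex.sel cis.sel) algebra
    then show ?thesis by simp
  qed
  show ?thesis
  proof (cases "\<zeta> = 0")
    case True
    have "B 0 = 0" using B(1) has_derivative_linear linear_0 by blast
    then have "area_ratio \<zeta> = m 0"
      using B(3) by (simp add: True circle_total_def circle_integral_def)
    have "area_form (D v) (D v') = area_form (q *\<^sub>R v) (q *\<^sub>R v')"
      unfolding Deq rot by (simp add: True)
    also have "\<dots> = q\<^sup>2 * area_form v v'"
      by (simp add: area_form_def power2_eq_square algebra_simps)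
    finally show ?thesis using q(2) \<open>area_ratio \<zeta> = m 0\<close> True by (simp add: power2_eq_square)
  next
    case False
    have "area_form (D \<zeta>) (D (\<i> * \<zeta>)) =
        (B \<zeta> / (2 * q) + q) * q * (X (\<i> * \<zeta>) + 1) * area_form \<zeta> (\<i> * \<zeta>)"
      unfolding Deq rot by (simp add: B(2) area_form_def algebra_simps)
    also have "(B \<zeta> / (2 * q) + q) * q = B \<zeta> / 2 + area_ratio \<zeta>"
      using q by (simp add: distrib_right)
    also have "\<dots> = circle_total \<zeta> / (2 * pi)"
      using B(3) by simp
    finally have "area_form (D \<zeta>) (D (\<i> * \<zeta>)) = m (Re \<zeta>) * area_form \<zeta> (\<i> * \<zeta>)"
      using Np by (simp add: X(2) pi_gt_zero less_imp_neq[symmetric])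
    moreover have "area_form \<zeta> (\<i> * \<zeta>) \<noteq> 0"
      using False by (simp add: area_form_def complex_eq_iff) (smt (verit) zero_less_mult_iff not_square_less_zero)
    ultimately show ?thesis by (rule area_form_linear_eqI[OF lin])
  qed
qed

end


context disc_density begin

lemma norm_straighten:
  assumes "\<zeta> \<in> ball 0 \<rho>"
  shows "(cmod (straighten \<zeta>))\<^sup>2 = area_ratio \<zeta> * (cmod \<zeta>)\<^sup>2"
  using area_ratio_pos[OF assms] by (simp add: straighten_def norm_mult power_mult_distrib)

lemma cis_circle_has_derivative:
  assumes "(f has_derivative D) (at (of_real r * cis \<theta>))"
  shows "((\<lambda>\<theta>. f (of_real r * cis \<theta>)) has_real_derivative D (\<i> * (of_real r * cis \<theta>))) (at \<theta>)"
proof -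
  have c: "((\<lambda>\<theta>. of_real r * cis \<theta>) has_derivative (\<lambda>t. t *\<^sub>R (\<i> * (of_real r * cis \<theta>)))) (at \<theta>)"
    by (auto intro!: derivative_eq_intros simp: mult_ac scaleR_conv_of_real)
  have "((\<lambda>\<theta>. f (of_real r * cis \<theta>)) has_derivative (\<lambda>t. D (t *\<^sub>R (\<i> * (of_real r * cis \<theta>))))) (at \<theta>)"
    by (rule has_derivative_compose[OF c assms])
  moreover have "D (t *\<^sub>R w) = D w * t" for t w
    using linear_cmul[OF has_derivative_linear[OF assms]] by simp
  ultimately show ?thesis by (simp add: has_field_derivative_def)
qed

lemma rotation_invariant:
  assumes D: "\<And>\<zeta>. \<zeta> \<in> ball 0 \<rho> \<Longrightarrow> \<exists>D. (f has_derivative D) (at \<zeta>) \<and> D (\<i> * \<zeta>) = 0"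
    and \<zeta>: "\<zeta> \<in> ball 0 \<rho>"
  shows "f \<zeta> = (f (of_real (cmod \<zeta>)) :: real)"
proof -
  define r where "r = cmod \<zeta>"
  have r: "of_real r * cis \<theta> \<in> ball 0 \<rho>" for \<theta> using \<zeta> by (simp add: r_def norm_mult)
  have "((\<lambda>\<theta>. f (of_real r * cis \<theta>)) has_real_derivative 0) (at \<theta>)" for \<theta>
    using D[OF r, of \<theta>] cis_circle_has_derivative by force
  then have "f (of_real r * cis (Arg \<zeta>)) = f (of_real r * cis 0)"
    using DERIV_isconst_all by blast
  moreover have "of_real r * cis (Arg \<zeta>) = \<zeta>"
    unfolding r_def using rcis_cmod_Arg[of \<zeta>] by (simp add: rcis_def)
  ultimately show ?thesis by (simp add: r_def)
qed

lemma area_ratio_rotation: "\<zeta> \<in> ball 0 \<rho> \<Longrightarrow> area_ratio \<zeta> = area_ratio (of_real (cmod \<zeta>))"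
  by (rule rotation_invariant) (metis area_ratio_derivative)

text \<open>The mass of the concentric disc of radius $r$.\<close>

definition disc_area :: "real \<Rightarrow> real" where
  "disc_area r = pi * (r\<^sup>2 * area_ratio (of_real r))"

lemma disc_area_0: "disc_area 0 = 0" by (simp add: disc_area_def)

lemma disc_area_straighten:
  assumes "\<zeta> \<in> ball 0 \<rho>"
  shows "pi * (cmod (straighten \<zeta>))\<^sup>2 = disc_area (cmod \<zeta>)"
  using norm_straighten[OF assms] area_ratio_rotation[OF assms] by (simp add: disc_area_def)

lemma disc_area_has_derivative:
  assumes "\<bar>r\<bar> < \<rho>"
  shows "(disc_area has_real_derivative r * circle_total (of_real r)) (at r)"
proof -
  have r: "complex_of_real r \<in> ball 0 \<rho>" using assms by simp
  obtain D where D: "(area_ratio has_derivative D) (at (of_real r))"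
    "D (of_real r) + 2 * area_ratio (of_real r) = circle_total (of_real r) / pi"
    using area_ratio_derivative[OF r] .
  have c: "(complex_of_real has_derivative (\<lambda>t. t *\<^sub>R 1)) (at r)"
    by (auto intro!: derivative_eq_intros simp: scaleR_conv_of_real)
  have "((\<lambda>r. area_ratio (of_real r)) has_derivative (\<lambda>t. D (t *\<^sub>R 1))) (at r)"
    by (rule has_derivative_compose[OF c D(1)])
  moreover have lin: "D (t *\<^sub>R w) = D w * t" for t w
    using linear_cmul[OF has_derivative_linear[OF D(1)]] by simp
  ultimately have "((\<lambda>r. area_ratio (of_real r)) has_real_derivative D 1) (at r)"
    by (simp add: has_field_derivative_def)
  then have "(disc_area has_real_derivative
      pi * (2 * r * area_ratio (of_real r) + r\<^sup>2 * D 1)) (at r)"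
    unfolding disc_area_def[abs_def] by (auto intro!: derivative_eq_intros)
  moreover have "D (of_real r) = D 1 * r"
    using lin[of r 1] by (simp add: scaleR_conv_of_real)
  then have "pi * (2 * r * area_ratio (of_real r) + r\<^sup>2 * D 1) =
      r * (pi * (D (of_real r) + 2 * area_ratio (of_real r)))"
    by (simp add: power2_eq_square algebra_simps)
  moreover have "\<dots> = r * circle_total (of_real r)"
    unfolding D(2) by (simp add: pi_gt_zero less_imp_neq[symmetric])
  ultimately show ?thesis by simp
qed

lemma continuous_on_disc_area: "continuous_on {-\<rho><..<\<rho>} disc_area"
proof (intro continuous_at_imp_continuous_on ballI)
  show "isCont disc_area r" if "r \<in> {-\<rho><..<\<rho>}" for r
    by (rule DERIV_isCont[OF disc_area_has_derivative]) (use that in auto)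
qed

lemma disc_area_strict_mono:
  assumes "0 \<le> r" "r < r'" "r' < \<rho>"
  shows "disc_area r < disc_area r'"
proof (rule DERIV_pos_imp_increasing_open[OF assms(2)])
  show "\<exists>y. (disc_area has_real_derivative y) (at x) \<and> 0 < y" if "r < x" "x < r'" for x
    using that assms circle_total_pos[of "of_real x"]
    by (intro exI[of _ "x * circle_total (of_real x)"] conjI disc_area_has_derivative mult_pos_pos) auto
  show "continuous_on {r..r'} disc_area"
    by (rule continuous_on_subset[OF continuous_on_disc_area]) (use assms in auto)
qed

lemma straighten_angle:
  "straighten (of_real r * cis \<theta>) =
    of_real (sqrt (area_ratio (of_real r * cis \<theta>)) * r) * cis (\<theta> + twist (of_real r * cis \<theta>))"
  by (simp add: straighten_def scaleR_conv_of_real cis_mult[symmetric] mult_ac)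

text \<open>On each circle the straightened angle increases strictly, and by the lemma below it is continuous;
  over a full turn it grows by $2\pi$. Hence the straightening map is a bijection between circles.\<close>

lemma angle_strict_mono:
  assumes "0 < r" "r < \<rho>" "\<theta> < \<theta>'"
  shows "\<theta> + twist (of_real r * cis \<theta>) < \<theta>' + twist (of_real r * cis \<theta>')"
proof (rule DERIV_pos_imp_increasing[OF assms(3)])
  fix x
  let ?z = "of_real r * cis x"
  have z: "?z \<in> ball 0 \<rho>" using assms by (simp add: norm_mult)
  obtain D where D: "(twist has_derivative D) (at ?z)"
    "D (\<i> * ?z) + 1 = 2 * pi * m (Re ?z) / circle_total ?z"
    using twist_derivative[OF z] .
  have "\<bar>Re ?z\<bar> < \<rho>" using z abs_Re_le_cmod[of ?z] by simp
  then have "0 < 2 * pi * m (Re ?z) / circle_total ?z"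
    using density_pos circle_total_pos[OF z] by (intro divide_pos_pos mult_pos_pos) (auto simp: pi_gt_zero)
  then have "0 < 1 + D (\<i> * ?z)"
    using D(2) by linarith
  moreover have "((\<lambda>x. x + twist (of_real r * cis x)) has_real_derivative 1 + D (\<i> * ?z)) (at x)"
    by (intro DERIV_add DERIV_ident cis_circle_has_derivative D(1))
  ultimately show "\<exists>y. ((\<lambda>x. x + twist (of_real r * cis x)) has_real_derivative y) (at x) \<and> 0 < y"
    by blast
qed

lemma continuous_on_angle:
  assumes "0 \<le> r" "r < \<rho>"
  shows "continuous_on S (\<lambda>\<theta>. \<theta> + twist (of_real r * cis \<theta>))"
  by (intro continuous_intros continuous_on_compose2[OF smooth_on_imp_continuous_on[OF smooth_on_twist]])
    (use assms in \<open>auto simp: norm_mult\<close>)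

lemma polar_form:
  obtains \<theta> where "0 \<le> \<theta>" "\<theta> < 2 * pi" "\<zeta> = of_real (cmod \<zeta>) * cis \<theta>"
proof -
  have "\<zeta> = of_real (cmod \<zeta>) * cis (Arg2pi \<zeta>)"
    using Arg2pi_eq[of \<zeta>] by (simp add: cis_conv_exp)
  then show thesis using that Arg2pi_ge_0 Arg2pi_lt_2pi by blast
qed

lemma inj_on_straighten: "inj_on straighten (ball 0 \<rho>)"
proof -
  have main: "\<theta> = \<theta>'"
    if r: "0 < r" "r < \<rho>" and \<theta>: "0 \<le> \<theta>" "\<theta> \<le> \<theta>'" "\<theta>' < 2 * pi"
      and eq: "straighten (of_real r * cis \<theta>) = straighten (of_real r * cis \<theta>')" for r \<theta> \<theta>'
  proof (rule ccontr)
    assume "\<theta> \<noteq> \<theta>'"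
    then have lt: "\<theta> < \<theta>'" using \<theta> by simp
    let ?\<psi> = "\<lambda>\<theta>. \<theta> + twist (of_real r * cis \<theta>)"
    have z: "of_real r * cis x \<in> ball 0 \<rho>" for x using r by (simp add: norm_mult)
    have B: "area_ratio (of_real r * cis x) = area_ratio (of_real r)" for x
      using area_ratio_rotation[OF z, of x] r by (simp add: norm_mult)
    have "area_ratio (of_real r) > 0" using area_ratio_pos r by simp
    then have "cis (?\<psi> \<theta>) = cis (?\<psi> \<theta>')"
      using eq r unfolding straighten_angle B by simp
    then have "sin (?\<psi> \<theta>') = sin (?\<psi> \<theta>) \<and> cos (?\<psi> \<theta>') = cos (?\<psi> \<theta>)"
      by (metis cis.sel)
    then obtain n :: int where n: "?\<psi> \<theta>' = ?\<psi> \<theta> + 2 * pi * n" using sin_cos_eq_iff by blast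
    have "?\<psi> \<theta> < ?\<psi> \<theta>'" by (rule angle_strict_mono[OF r lt])
    then have "0 < 2 * pi * n" using n by simp
    then have "n \<ge> 1" by (simp add: zero_less_mult_iff)
    \<comment> \<open>Equal images force the straightened angles to differ by a full turn at least, but one turn starting from $\theta$ is not yet completed at $\theta'$.\<close>
    then have "2 * pi * n \<ge> 2 * pi * 1" by (intro mult_left_mono) auto
    moreover have "?\<psi> \<theta>' < ?\<psi> (\<theta> + 2 * pi)"
      by (rule angle_strict_mono[OF r]) (use \<theta> in simp)
    then have "?\<psi> \<theta>' < ?\<psi> \<theta> + 2 * pi" by (simp add: cis_mult[symmetric])
    ultimately show False using n by simp
  qed
  show ?thesis
  proof (rule inj_onI)
    fix z z' assume z: "z \<in> ball 0 \<rho>" "z' \<in> ball 0 \<rho>" and eq: "straighten z = straighten z'"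
    have "disc_area (cmod z) = disc_area (cmod z')"
      using disc_area_straighten[OF z(1)] disc_area_straighten[OF z(2)] eq by simp
    then have r: "cmod z = cmod z'"
      using disc_area_strict_mono[of "cmod z" "cmod z'"] disc_area_strict_mono[of "cmod z'" "cmod z"] z
      by (cases "cmod z" "cmod z'" rule: linorder_cases) auto
    obtain \<theta> where \<theta>: "0 \<le> \<theta>" "\<theta> < 2 * pi" "z = of_real (cmod z) * cis \<theta>" by (rule polar_form)
    obtain \<theta>' where \<theta>': "0 \<le> \<theta>'" "\<theta>' < 2 * pi" "z' = of_real (cmod z') * cis \<theta>'" by (rule polar_form)
    show "z = z'"
    proof (cases "cmod z = 0")
      case False
      then have "\<theta> = \<theta>'"
        using main[of "cmod z" \<theta> \<theta>'] main[of "cmod z" \<theta>' \<theta>] \<theta> \<theta>' z eq r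
        by (cases "\<theta> \<le> \<theta>'") auto
      then show ?thesis using \<theta>(3) \<theta>'(3) r by simp
    qed (use r in simp)
  qed
qed

lemma straighten_surj_circle:
  assumes r: "0 \<le> r" "r < \<rho>" and u: "pi * (cmod u)\<^sup>2 = disc_area r"
  shows "\<exists>\<zeta>. cmod \<zeta> = r \<and> straighten \<zeta> = u"
proof -
  let ?\<psi> = "\<lambda>\<theta>. \<theta> + twist (of_real r * cis \<theta>)"
  have z: "of_real r * cis x \<in> ball 0 \<rho>" for x using r by (simp add: norm_mult)
  have B: "area_ratio (of_real r * cis x) = area_ratio (of_real r)" for x
    using area_ratio_rotation[OF z, of x] r by (simp add: norm_mult)
  have Bp: "area_ratio (of_real r) > 0" using area_ratio_pos r by simp
  have "(cmod u)\<^sup>2 = (sqrt (area_ratio (of_real r)) * r)\<^sup>2"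
    using u Bp by (simp add: disc_area_def power_mult_distrib pi_gt_zero less_imp_neq[symmetric] mult.commute)
  then have nu: "cmod u = sqrt (area_ratio (of_real r)) * r"
    using r Bp power2_eq_iff_nonneg[of "cmod u" "sqrt (area_ratio (of_real r)) * r"] by auto
  \<comment> \<open>Shift the argument of $u$ by full turns into the range of the straightened angle.\<close>
  define n where "n = \<lceil>(?\<psi> 0 - Arg u) / (2 * pi)\<rceil>"
  have "(?\<psi> 0 - Arg u) / (2 * pi) \<le> n" "n < (?\<psi> 0 - Arg u) / (2 * pi) + 1"
    unfolding n_def by (auto simp: ceiling_correct) linarith
  then have n: "?\<psi> 0 \<le> Arg u + 2 * pi * n" "Arg u + 2 * pi * n \<le> ?\<psi> 0 + 2 * pi"
    by (auto simp: field_simps pi_gt_zero)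
  have "?\<psi> (2 * pi) = ?\<psi> 0 + 2 * pi" by simp
  then obtain \<theta> where \<theta>: "?\<psi> \<theta> = Arg u + 2 * pi * n"
    using IVT'[of ?\<psi> 0 "Arg u + 2 * pi * n" "2 * pi"] n continuous_on_angle[OF r] by auto
  have "straighten (of_real r * cis \<theta>) = of_real (cmod u) * cis (Arg u + 2 * pi * n)"
    unfolding straighten_angle B nu \<theta> by simp
  also have "\<dots> = of_real (cmod u) * cis (Arg u)"
    by (simp add: cis_mult[symmetric])
  also have "\<dots> = u" using rcis_cmod_Arg[of u] by (simp add: rcis_def)
  finally show ?thesis using r by (intro exI[of _ "of_real r * cis \<theta>"]) (simp add: norm_mult)
qed

end


section \<open>Action-angle coordinates of a quartic well\<close>

text \<open>The one-dimensional system with energy $w^2/2+cz^2+\frac{k}{2}z^4$. The bound relating $k$ and $\rho$ keeps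
  the energies below $\rho^2/2$ under the height of the barrier at $z^2=-c/k$ that is present when $k<0$.\<close>

locale quartic_well =
  fixes c k \<rho> :: real
  assumes c_pos: "0 < c" and radius_pos: "0 < \<rho>" and k_bound: "\<bar>k\<bar> * \<rho>\<^sup>2 \<le> c\<^sup>2"
begin

text \<open>Expressed in the coordinate $s$, this is $c+kz^2$.\<close>

definition stiffness :: "real \<Rightarrow> real" where
  "stiffness s = sqrt (c\<^sup>2 + k * s\<^sup>2)"

text \<open>The inverse $z(s)$ of the substitution $s=z\sqrt{2c+kz^2}$.\<close>

definition position :: "real \<Rightarrow> real" where
  "position s = s / sqrt (c + stiffness s)"

text \<open>The derivative $dz/ds$, which is the density of the area form in the coordinates $(s,w)$.\<close>

definition position_deriv :: "real \<Rightarrow> real" where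
  "position_deriv s = sqrt (c + stiffness s) / (2 * stiffness s)"

text \<open>The coordinate $s$ with $s^2/2=cz^2+\frac{k}{2}z^4$.\<close>

definition flatten :: "real \<Rightarrow> real" where
  "flatten z = z * sqrt (2 * c + k * z\<^sup>2)"

text \<open>A phase point $(z,w)$ of the well is encoded as the complex number $z+iw$.\<close>

definition well_energy :: "complex \<Rightarrow> real" where
  "well_energy u = (Im u)\<^sup>2 / 2 + c * (Re u)\<^sup>2 + k / 2 * (Re u) ^ 4"

text \<open>The coordinate change that turns energy levels into circles.\<close>

definition flat :: "complex \<Rightarrow> complex" where
  "flat u = Complex (flatten (Re u)) (Im u)"

text \<open>The first condition singles out the region around the origin on which $z\mapsto s$ is increasing; for
  $k<0$ it excludes the points beyond the barrier.\<close>

definition well :: "complex set" where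
  "well = {u. 0 < c + k * (Re u)\<^sup>2 \<and> well_energy u < \<rho>\<^sup>2 / 2}"

lemma radicand_pos:
  assumes "\<bar>s\<bar> < \<rho>"
  shows "0 < c\<^sup>2 + k * s\<^sup>2"
proof (cases "k = 0")
  case True
  then show ?thesis using c_pos by simp
next
  case False
  have "s\<^sup>2 < \<rho>\<^sup>2" using assms by (simp add: abs_square_less_1 power2_strict_mono)
  then have "\<bar>k\<bar> * s\<^sup>2 < \<bar>k\<bar> * \<rho>\<^sup>2" using False by simp
  moreover have "- (\<bar>k\<bar> * s\<^sup>2) \<le> k * s\<^sup>2"
    using mult_right_mono[of "- \<bar>k\<bar>" k "s\<^sup>2"] by simp
  ultimately show ?thesis using k_bound by linarith
qed

lemma stiffness_pos: "\<bar>s\<bar> < \<rho> \<Longrightarrow> 0 < stiffness s"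
  using radicand_pos by (simp add: stiffness_def)

lemma stiffness_sq: "\<bar>s\<bar> < \<rho> \<Longrightarrow> (stiffness s)\<^sup>2 = c\<^sup>2 + k * s\<^sup>2"
  using radicand_pos by (simp add: stiffness_def less_imp_le)

lemma position_deriv_pos: "\<bar>s\<bar> < \<rho> \<Longrightarrow> 0 < position_deriv s"
  using stiffness_pos c_pos by (simp add: position_deriv_def add_pos_pos)

lemma smooth_on_position_deriv: "smooth_on {-\<rho><..<\<rho>} position_deriv"
proof -
  have st: "smooth_on {-\<rho><..<\<rho>} stiffness"
    unfolding stiffness_def[abs_def]
    by (intro smooth_on_sqrt_compose smooth_on_add smooth_on_mult smooth_on_const smooth_on_power
        smooth_on_bounded_linear bounded_linear_ident radicand_pos) auto
  show ?thesis
    unfolding position_deriv_def[abs_def]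
  proof (intro smooth_on_divide smooth_on_sqrt_compose smooth_on_add smooth_on_mult smooth_on_const st)
    fix s assume "s \<in> {-\<rho><..<\<rho>}"
    then have "0 < stiffness s" by (intro stiffness_pos) auto
    then show "0 < c + stiffness s" "2 * stiffness s \<noteq> 0" using c_pos by auto
  qed auto
qed

sublocale disc_density \<rho> position_deriv
  by unfold_locales (auto simp: radius_pos smooth_on_position_deriv position_deriv_pos)

lemma flatten_sq:
  assumes "0 < c + k * z\<^sup>2"
  shows "(flatten z)\<^sup>2 = 2 * c * z\<^sup>2 + k * z ^ 4"
proof -
  have "0 \<le> 2 * c + k * z\<^sup>2" using assms c_pos by linarith
  then show ?thesis
    by (simp add: flatten_def power_mult_distrib algebra_simps power2_eq_square power4_eq_xxxx)
qed

lemma stiffness_flatten: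
  assumes "0 < c + k * z\<^sup>2"
  shows "stiffness (flatten z) = c + k * z\<^sup>2"
proof -
  have "c\<^sup>2 + k * (flatten z)\<^sup>2 = (c + k * z\<^sup>2)\<^sup>2"
    unfolding flatten_sq[OF assms] by (simp add: power2_eq_square power4_eq_xxxx algebra_simps)
  then show ?thesis using assms by (simp add: stiffness_def)
qed

lemma position_flatten:
  assumes "0 < c + k * z\<^sup>2"
  shows "position (flatten z) = z"
proof -
  have "0 < 2 * c + k * z\<^sup>2" using assms c_pos by linarith
  moreover have "c + stiffness (flatten z) = 2 * c + k * z\<^sup>2"
    using stiffness_flatten[OF assms] by simp
  ultimately show ?thesis by (simp add: position_def flatten_def)
qed

lemma position_sq:
  assumes "\<bar>s\<bar> < \<rho>"
  shows "c + k * (position s)\<^sup>2 = stiffness s"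
proof -
  have p: "0 < c + stiffness s" using stiffness_pos[OF assms] c_pos by simp
  have "k * s\<^sup>2 = (stiffness s - c) * (c + stiffness s)"
    using stiffness_sq[OF assms] by (simp add: power2_eq_square algebra_simps)
  then have "k * (s\<^sup>2 / (c + stiffness s)) = stiffness s - c"
    using p by simp
  then show ?thesis using p by (simp add: position_def power_divide)
qed

lemma flatten_position:
  assumes "\<bar>s\<bar> < \<rho>"
  shows "flatten (position s) = s"
proof -
  have p: "0 < c + stiffness s" using stiffness_pos[OF assms] c_pos by simp
  have "2 * c + k * (position s)\<^sup>2 = c + stiffness s" using position_sq[OF assms] by linarith
  then have "flatten (position s) = position s * sqrt (c + stiffness s)" by (simp only: flatten_def)
  then show ?thesis using p by (simp add: position_def)
qed

lemma cmod_flat: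
  assumes "0 < c + k * (Re u)\<^sup>2"
  shows "(cmod (flat u))\<^sup>2 = 2 * well_energy u"
  using flatten_sq[OF assms] by (simp add: cmod_power2 flat_def well_energy_def algebra_simps)

lemma well_energy_nonneg: "u \<in> well \<Longrightarrow> 0 \<le> well_energy u"
  using cmod_flat[of u] by (simp add: well_def) (metis zero_le_power2 zero_le_mult_iff zero_le_numeral not_numeral_le_zero)

lemma flat_in_ball: "u \<in> well \<Longrightarrow> flat u \<in> ball 0 \<rho>"
  using cmod_flat[of u] radius_pos power2_less_imp_less[of "cmod (flat u)" \<rho>] by (auto simp: well_def)

lemma open_well: "open well"
  unfolding well_def well_energy_def
  by (intro open_Collect_conj open_Collect_less continuous_intros) auto

lemma inj_on_flat: "inj_on flat well"
proof (rule inj_onI)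
  fix u v assume uv: "u \<in> well" "v \<in> well" and eq: "flat u = flat v"
  have "flatten (Re u) = flatten (Re v)" "Im u = Im v"
    using eq by (simp_all only: flat_def complex.inject)
  moreover have "position (flatten (Re u)) = Re u" "position (flatten (Re v)) = Re v"
    using uv by (simp_all add: position_flatten well_def)
  ultimately show "u = v" by (metis complex_eqI)
qed

text \<open>The inverse of the coordinate change.\<close>

definition unflat :: "complex \<Rightarrow> complex" where
  "unflat \<zeta> = Complex (position (Re \<zeta>)) (Im \<zeta>)"

lemma unflat_flat: "u \<in> well \<Longrightarrow> unflat (flat u) = u"
  by (simp add: unflat_def flat_def well_def position_flatten)

lemma unflat:
  assumes "\<zeta> \<in> ball 0 \<rho>"
  shows "unflat \<zeta> \<in> well" "flat (unflat \<zeta>) = \<zeta>" "well_energy (unflat \<zeta>) = (cmod \<zeta>)\<^sup>2 / 2"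
proof -
  have r: "\<bar>Re \<zeta>\<bar> < \<rho>" using assms abs_Re_le_cmod[of \<zeta>] by simp
  have p: "0 < c + k * (Re (unflat \<zeta>))\<^sup>2"
    using position_sq[OF r] stiffness_pos[OF r] by (simp add: unflat_def)
  show f: "flat (unflat \<zeta>) = \<zeta>"
    using flatten_position[OF r] by (simp add: unflat_def flat_def complex_eq_iff)
  show e: "well_energy (unflat \<zeta>) = (cmod \<zeta>)\<^sup>2 / 2" using cmod_flat[OF p] f by simp
  have "(cmod \<zeta>)\<^sup>2 < \<rho>\<^sup>2" using assms by (simp add: power2_strict_mono)
  then show "unflat \<zeta> \<in> well" using p e by (simp add: well_def)
qed

lemma continuous_on_unflat: "continuous_on (ball 0 \<rho>) unflat"
proof -
  have "0 < c + sqrt (c\<^sup>2 + k * (Re \<zeta>)\<^sup>2)" if "\<zeta> \<in> ball 0 \<rho>" for \<zeta>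
    using that abs_Re_le_cmod[of \<zeta>] stiffness_pos[of "Re \<zeta>"] c_pos
    by (simp add: stiffness_def add_pos_pos)
  then have "continuous_on (ball 0 \<rho>) (\<lambda>\<zeta>. position (Re \<zeta>))"
    unfolding position_def stiffness_def by (intro continuous_intros) force
  then show ?thesis unfolding unflat_def[abs_def] Complex_eq by (intro continuous_intros)
qed

lemma flatten_has_derivative:
  assumes "0 < c + k * z\<^sup>2"
  shows "(flatten has_real_derivative 1 / position_deriv (flatten z)) (at z)"
proof -
  have p: "0 < 2 * c + k * z\<^sup>2" using assms c_pos by linarith
  define q where "q = sqrt (2 * c + k * z\<^sup>2)"
  have q: "q > 0" "q * q = 2 * c + k * z\<^sup>2" using p by (auto simp: q_def)
  have "(flatten has_real_derivative q + z * (k * z / q)) (at z)"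
  proof -
    have "((\<lambda>z. 2 * c + k * z\<^sup>2) has_real_derivative 2 * k * z) (at z)"
      by (auto intro!: derivative_eq_intros)
    from DERIV_chain2[OF DERIV_real_sqrt[OF p] this]
    have "((\<lambda>z. sqrt (2 * c + k * z\<^sup>2)) has_real_derivative k * z / q) (at z)"
      by (rule DERIV_cong) (use q in \<open>simp add: q_def field_simps\<close>)
    from DERIV_mult[OF DERIV_ident this] show ?thesis
      unfolding flatten_def[abs_def] by (simp add: q_def mult.commute)
  qed
  moreover have "c + stiffness (flatten z) = 2 * c + k * z\<^sup>2"
    using stiffness_flatten[OF assms] by simp
  then have "1 / position_deriv (flatten z) = 2 * (c + k * z\<^sup>2) / q"
    using stiffness_flatten[OF assms] by (simp add: position_deriv_def q_def)
  moreover have "q + z * (k * z / q) = (q * q + k * z\<^sup>2) / q"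
    using q(1) by (simp add: field_simps power2_eq_square)
  ultimately show ?thesis using q(2) by (simp add: add.commute)
qed

text \<open>The area-preserving map of the well onto a round disc.\<close>

definition well_map :: "complex \<Rightarrow> complex" where
  "well_map u = straighten (flat u)"

lemma smooth_on_well_map: "smooth_on well well_map"
proof -
  have "smooth_on well (\<lambda>u. flatten (Re u) *\<^sub>R 1 + Im u *\<^sub>R \<i>)"
    unfolding flatten_def
  proof (intro smooth_on_add smooth_on_scaleR smooth_on_mult smooth_on_sqrt_compose smooth_on_const
      smooth_on_power smooth_on_bounded_linear open_well bounded_linear_Re bounded_linear_Im)
    show "0 < 2 * c + k * (Re u)\<^sup>2" if "u \<in> well" for u
      using that c_pos by (auto simp: well_def)
  qed
  moreover have "flatten (Re u) *\<^sub>R 1 + Im u *\<^sub>R \<i> = flat u" for u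
    by (simp add: flat_def complex_eq_iff)
  ultimately have "smooth_on well flat" by (simp add: fun_eq_iff[symmetric])
  then show ?thesis
    unfolding well_map_def[abs_def]
    using flat_in_ball by (intro smooth_on_compose[OF smooth_on_straighten] open_well) auto
qed

lemma area_form_well_map:
  assumes u: "u \<in> well" and E: "(well_map has_derivative E) (at u)"
  shows "area_form (E v) (E v') = area_form v v'"
proof -
  let ?J = "1 / position_deriv (flatten (Re u))"
  have p: "0 < c + k * (Re u)\<^sup>2" using u by (simp add: well_def)
  have f: "((\<lambda>u. flatten (Re u)) has_derivative (\<lambda>v. ?J * Re v)) (at u)"
    using has_derivative_compose[OF bounded_linear_imp_has_derivative[OF bounded_linear_Re]
        flatten_has_derivative[OF p, unfolded has_field_derivative_def]] .
  have "((\<lambda>u. flatten (Re u) *\<^sub>R 1 + Im u *\<^sub>R \<i>) has_derivative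
      (\<lambda>v. (?J * Re v) *\<^sub>R 1 + Im v *\<^sub>R \<i>)) (at u)"
    by (intro has_derivative_add has_derivative_scaleR_left f
        bounded_linear_imp_has_derivative bounded_linear_Im)
  moreover have "(\<lambda>u. flatten (Re u) *\<^sub>R 1 + Im u *\<^sub>R \<i>) = flat"
    by (auto simp: flat_def complex_eq_iff)
  ultimately have F: "(flat has_derivative (\<lambda>v. (?J * Re v) *\<^sub>R 1 + Im v *\<^sub>R \<i>)) (at u)" by simp
  have z: "flat u \<in> ball 0 \<rho>" by (rule flat_in_ball[OF u])
  obtain D where D: "(straighten has_derivative D) (at (flat u))"
    using smooth_on_has_derivative[OF smooth_on_straighten z] by blast
  have "\<bar>flatten (Re u)\<bar> < \<rho>" using z abs_Re_le_cmod[of "flat u"] by (simp add: flat_def)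
  then have m: "0 < position_deriv (flatten (Re u))" by (rule position_deriv_pos)
  have "(well_map has_derivative (\<lambda>v. D ((?J * Re v) *\<^sub>R 1 + Im v *\<^sub>R \<i>))) (at u)"
    unfolding well_map_def[abs_def] by (rule has_derivative_compose[OF F D])
  then have "E = (\<lambda>v. D ((?J * Re v) *\<^sub>R 1 + Im v *\<^sub>R \<i>))"
    by (rule has_derivative_unique[OF E])
  then show ?thesis
    using m by (simp add: area_form_straighten[OF z D]) (simp add: area_form_def flat_def field_simps)
qed

lemma inj_on_well_map: "inj_on well_map well"
  unfolding well_map_def[abs_def]
  using comp_inj_on[OF inj_on_flat inj_on_subset[OF inj_on_straighten], of] flat_in_ball
  by (auto simp: o_def image_subset_iff)

text \<open>The phase area enclosed by the orbit of energy $e$, whose image is a circle of radius $\sqrt{2e}$ in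
  the coordinates $(s,w)$.\<close>

definition action :: "real \<Rightarrow> real" where
  "action e = disc_area (sqrt (2 * e))"

lemma action_well_map:
  assumes "u \<in> well"
  shows "pi * (cmod (well_map u))\<^sup>2 = action (well_energy u)"
proof -
  have "sqrt (2 * well_energy u) = cmod (flat u)"
    using cmod_flat[of u] assms by (simp add: well_def real_sqrt_unique)
  then show ?thesis
    using disc_area_straighten[OF flat_in_ball[OF assms]] by (simp add: action_def well_map_def)
qed

lemma sqrt_energy: "0 \<le> e \<Longrightarrow> e < \<rho>\<^sup>2 / 2 \<Longrightarrow> 0 \<le> sqrt (2 * e) \<and> sqrt (2 * e) < \<rho>"
  using radius_pos real_less_lsqrt[of \<rho> "2 * e"] by (simp add: real_sqrt_less_iff real_less_lsqrt)

lemma well_map_surj: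
  assumes e: "0 \<le> e" "e < \<rho>\<^sup>2 / 2" and x: "pi * (cmod x)\<^sup>2 = action e"
  shows "\<exists>u\<in>well. well_energy u = e \<and> well_map u = x"
proof -
  obtain \<zeta> where \<zeta>: "cmod \<zeta> = sqrt (2 * e)" "straighten \<zeta> = x"
    using straighten_surj_circle[of "sqrt (2 * e)" x] sqrt_energy[OF e] x by (auto simp: action_def)
  have "\<zeta> \<in> ball 0 \<rho>" using \<zeta> sqrt_energy[OF e] by simp
  from unflat[OF this] \<zeta> e show ?thesis
    by (intro bexI[of _ "unflat \<zeta>"]) (simp_all add: well_map_def)
qed

lemma action_0: "action 0 = 0" by (simp add: action_def disc_area_0)

lemma action_strict_mono: "0 \<le> e \<Longrightarrow> e < e' \<Longrightarrow> e' < \<rho>\<^sup>2 / 2 \<Longrightarrow> action e < action e'"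
  unfolding action_def using sqrt_energy[of e'] by (intro disc_area_strict_mono) auto

lemma continuous_on_action: "continuous_on {0..<\<rho>\<^sup>2 / 2} action"
  unfolding action_def[abs_def]
proof (intro continuous_on_compose2[OF continuous_on_disc_area] continuous_intros image_subsetI)
  fix e assume "e \<in> {0..<\<rho>\<^sup>2 / 2}"
  then have "0 \<le> sqrt (2 * e)" "sqrt (2 * e) < \<rho>" using sqrt_energy[of e] by auto
  then show "sqrt (2 * e) \<in> {- \<rho><..<\<rho>}"
    unfolding greaterThanLessThan_iff using radius_pos by linarith
qed

end

text \<open>The derivative $dz/ds$ as a function of $x=c^2+ks^2$.\<close>

definition period_density :: "real \<Rightarrow> real \<Rightarrow> real" where
  "period_density c x = sqrt (c + sqrt x) / (2 * sqrt x)"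

text \<open>The period of the orbit of energy $e$ in the well with quartic coefficient $k$ is the value at
  $\sigma=ke$. One function thus serves both wells, positive arguments belonging to the hardening one and
  negative arguments to the softening one.\<close>

definition period :: "real \<Rightarrow> real \<Rightarrow> real" where
  "period c \<sigma> = integral {0..2 * pi} (\<lambda>t. period_density c (c\<^sup>2 + 2 * \<sigma> * (cos t)\<^sup>2))"

lemma (in quartic_well) action_has_derivative:
  assumes e: "0 < e" "e < \<rho>\<^sup>2 / 2"
  shows "(action has_real_derivative period c (k * e)) (at e)"
proof -
  let ?r = "sqrt (2 * e)"
  have r: "0 < ?r" "?r < \<rho>" using sqrt_energy[of e] e by auto
  have "((\<lambda>e. sqrt (2 * e)) has_real_derivative 1 / ?r) (at e)"
    using e by (auto intro!: derivative_eq_intros simp: field_simps)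
  from DERIV_chain2[OF disc_area_has_derivative this] have
    "(action has_real_derivative ?r * circle_total (of_real ?r) * (1 / ?r)) (at e)"
    unfolding action_def[abs_def] using r by auto
  moreover have "circle_total (of_real ?r) = period c (k * e)"
    unfolding circle_total_def circle_integral_def period_def
    using e by (intro integral_cong)
      (simp add: position_deriv_def period_density_def stiffness_def inner_complex_def
        power_mult_distrib mult_ac)
  ultimately show ?thesis using r by simp
qed


section \<open>Log-convexity of the period\<close>

text \<open>Hoelder's inequality in the form needed here; it follows by integrating the weighted
  inequality of arithmetic and geometric means for the normalised integrands.\<close>

lemma integral_powr_mean_le:
  fixes f g h :: "real \<Rightarrow> real"
  assumes cont: "continuous_on {\<alpha>..\<beta>} f" "continuous_on {\<alpha>..\<beta>} g" "continuous_on {\<alpha>..\<beta>} h"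
    and pos: "\<And>t. t \<in> {\<alpha>..\<beta>} \<Longrightarrow> 0 < f t" "\<And>t. t \<in> {\<alpha>..\<beta>} \<Longrightarrow> 0 < g t"
    and le: "\<And>t. t \<in> {\<alpha>..\<beta>} \<Longrightarrow> h t \<le> f t powr l * g t powr (1 - l)"
    and l: "0 \<le> l" "l \<le> 1" and ab: "\<alpha> < \<beta>"
  shows "integral {\<alpha>..\<beta>} h \<le> integral {\<alpha>..\<beta>} f powr l * integral {\<alpha>..\<beta>} g powr (1 - l)"
proof -
  define F where "F = integral {\<alpha>..\<beta>} f"
  define G where "G = integral {\<alpha>..\<beta>} g"
  have "integral {\<alpha>..\<beta>} (\<lambda>t. 0) < F" "integral {\<alpha>..\<beta>} (\<lambda>t. 0) < G"
    unfolding F_def G_def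
    by (rule integral_less_real; use ab pos cont in simp)+
  then have FG: "0 < F" "0 < G" by simp_all
  let ?K = "F powr l * G powr (1 - l)"
  have K: "0 < ?K" using FG by simp
  have "h t \<le> ?K * (l / F * f t + (1 - l) / G * g t)" if t: "t \<in> {\<alpha>..\<beta>}" for t
  proof -
    have "(f t / F) powr l * (g t / G) powr (1 - l) \<le> l * (f t / F) + (1 - l) * (g t / G)"
      using pos[OF t] FG l by (intro Youngs_inequality_0) auto
    moreover have "(f t / F) powr l * (g t / G) powr (1 - l) = f t powr l * g t powr (1 - l) / ?K"
      using pos[OF t] FG by (simp add: powr_divide)
    ultimately have "f t powr l * g t powr (1 - l) \<le> (l * (f t / F) + (1 - l) * (g t / G)) * ?K"
      using K by (simp only: pos_divide_le_eq)
    with le[OF t] show ?thesis by (simp add: mult.commute)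
  qed
  then have "integral {\<alpha>..\<beta>} h \<le> integral {\<alpha>..\<beta>} (\<lambda>t. ?K * (l / F * f t + (1 - l) / G * g t))"
    by (intro integral_le integrable_continuous_real continuous_intros cont)
  also have "\<dots> = ?K * (l / F * integral {\<alpha>..\<beta>} f + (1 - l) / G * integral {\<alpha>..\<beta>} g)"
  proof -
    have "integral {\<alpha>..\<beta>} (\<lambda>t. l / F * f t + (1 - l) / G * g t)
        = integral {\<alpha>..\<beta>} (\<lambda>t. l / F * f t) + integral {\<alpha>..\<beta>} (\<lambda>t. (1 - l) / G * g t)"
      by (intro integral_add integrable_continuous_real continuous_intros cont)
    then show ?thesis by simp
  qed
  also have "\<dots> = ?K" using FG by (simp add: F_def[symmetric] G_def[symmetric])
  finally show ?thesis by (simp add: F_def G_def)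
qed

text \<open>The logarithm $\frac{1}{2}\ln(c+\sqrt x)-\frac{1}{2}\ln x-\ln 2$ has derivative
  $-\frac{1}{4x}\bigl(1+\frac{c}{c+\sqrt x}\bigr)$, which is visibly increasing.\<close>

lemma ln_period_density_convex:
  assumes "0 < c"
  shows "convex_on {0<..} (\<lambda>x. ln (period_density c x))"
proof (rule convex_on_realI)
  show "connected {0::real<..}" by simp
next
  fix x :: real assume "x \<in> {0<..}"
  then have x: "0 < x" by simp
  have p: "0 < c + sqrt x" using assms x by (simp add: add_pos_pos)
  have s: "sqrt x * sqrt x = x" "0 < sqrt x" using x by auto
  have "((\<lambda>x. ln (c + sqrt x)) has_real_derivative 1 / (c + sqrt x) * (inverse (sqrt x) / 2)) (at x)"
    by (rule DERIV_chain2[where g="\<lambda>x. c + sqrt x", OF DERIV_ln_divide[OF p]])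
      (use DERIV_add[OF DERIV_const DERIV_real_sqrt[OF x]] in simp)
  from DERIV_diff[OF DERIV_cdivide[OF this, of 2] DERIV_cdivide[OF DERIV_ln_divide[OF x], of 2]]
  have "((\<lambda>x. ln (c + sqrt x) / 2 - ln x / 2) has_real_derivative
      1 / (c + sqrt x) * (inverse (sqrt x) / 2) / 2 - 1 / x / 2) (at x)" .
  also have "1 / (c + sqrt x) * (inverse (sqrt x) / 2) / 2 - 1 / x / 2
      = - (1 / (4 * x)) * (1 + c / (c + sqrt x))"
  proof -
    have "1 / (c + sqrt x) * (inverse (sqrt x) / 2) / 2 = sqrt x / (4 * x * (c + sqrt x))"
    proof -
      have "inverse (sqrt x) = sqrt x / x" using s by (simp add: field_simps)
      then show ?thesis by simp
    qed
    moreover have "1 + c / (c + sqrt x) = 2 - sqrt x / (c + sqrt x)"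
      using p by (simp add: field_simps)
    ultimately show ?thesis using p x by (simp add: right_diff_distrib)
  qed
  finally have "((\<lambda>x. ln (c + sqrt x) / 2 - ln x / 2) has_real_derivative
      - (1 / (4 * x)) * (1 + c / (c + sqrt x))) (at x)" .
  from DERIV_diff[OF this DERIV_const[of "ln 2"]]
  have "((\<lambda>x. ln (c + sqrt x) / 2 - ln x / 2 - ln 2) has_real_derivative
      - (1 / (4 * x)) * (1 + c / (c + sqrt x))) (at x)" by simp
  then show "((\<lambda>x. ln (period_density c x)) has_real_derivative
      - (1 / (4 * x)) * (1 + c / (c + sqrt x))) (at x)"
  proof (rule has_field_derivative_transform_within_open)
    show "x \<in> {0<..}" "open {0::real<..}" using x by auto
    fix y :: real assume "y \<in> {0<..}"
    then have y: "0 < y" by simp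
    then have "0 < c + sqrt y" using assms by (simp add: add_pos_pos)
    then show "ln (c + sqrt y) / 2 - ln y / 2 - ln 2 = ln (period_density c y)"
      using y by (simp add: period_density_def ln_div ln_mult ln_sqrt)
  qed
next
  fix x y :: real assume xy: "x \<in> {0<..}" "y \<in> {0<..}" "x \<le> y"
  then have "sqrt x \<le> sqrt y" "0 < sqrt x" by auto
  then have "c / (c + sqrt y) \<le> c / (c + sqrt x)" "0 \<le> c / (c + sqrt y)"
    using assms by (auto intro!: divide_left_mono mult_pos_pos add_pos_pos)
  moreover have "1 / (4 * y) \<le> 1 / (4 * x)" using xy by (simp add: field_simps)
  ultimately have "1 / (4 * y) * (1 + c / (c + sqrt y)) \<le> 1 / (4 * x) * (1 + c / (c + sqrt x))"
    using xy by (intro mult_mono) auto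
  then show "- (1 / (4 * x)) * (1 + c / (c + sqrt x)) \<le> - (1 / (4 * y)) * (1 + c / (c + sqrt y))"
    by simp
qed

lemma period_density_pos: "0 < c \<Longrightarrow> 0 < x \<Longrightarrow> 0 < period_density c x"
  by (simp add: period_density_def add_pos_pos)

lemma period_density_powr_mean_le:
  assumes c: "0 < c" and xy: "0 < x" "0 < y" and l: "0 \<le> l" "l \<le> 1"
  shows "period_density c (l * x + (1 - l) * y)
    \<le> period_density c x powr l * period_density c y powr (1 - l)"
proof -
  have z: "0 < l * x + (1 - l) * y"
    using convexD[of "{0<..}" x y l "1 - l"] xy l by (simp add: convex_real_interval)
  have "ln (period_density c (l *\<^sub>R x + (1 - l) *\<^sub>R y))
      \<le> l * ln (period_density c x) + (1 - l) * ln (period_density c y)"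
    using ln_period_density_convex[OF c] xy l unfolding convex_on_def by auto
  also have "\<dots> = ln (period_density c x powr l * period_density c y powr (1 - l))"
    using period_density_pos[OF c xy(1)] period_density_pos[OF c xy(2)]
    by (simp add: ln_mult ln_powr)
  finally have "ln (period_density c (l * x + (1 - l) * y))
      \<le> ln (period_density c x powr l * period_density c y powr (1 - l))"
    by (simp only: real_scaleR_def)
  moreover have "0 < period_density c x powr l * period_density c y powr (1 - l)"
    using period_density_pos[OF c xy(1)] period_density_pos[OF c xy(2)] by simp
  ultimately show ?thesis
    using ln_le_cancel_iff[OF period_density_pos[OF c z]] by blast
qed

lemma period_radicand_pos:
  fixes c \<sigma> t :: real
  assumes "0 < c" "- (c\<^sup>2 / 2) < \<sigma>"
  shows "0 < c\<^sup>2 + 2 * \<sigma> * (cos t)\<^sup>2"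
proof (cases "0 \<le> \<sigma>")
  case True
  then show ?thesis using assms by (simp add: add_pos_nonneg)
next
  case False
  then have "\<sigma> * 1 \<le> \<sigma> * (cos t)\<^sup>2"
    by (intro mult_left_mono_neg) (auto simp: abs_square_le_1)
  then show ?thesis using assms by linarith
qed

lemma continuous_on_period_integrand:
  assumes "0 < c" "- (c\<^sup>2 / 2) < \<sigma>"
  shows "continuous_on S (\<lambda>t. period_density c (c\<^sup>2 + 2 * \<sigma> * (cos t)\<^sup>2))"
  unfolding period_density_def
  using period_radicand_pos[OF assms] by (intro continuous_intros) (auto simp: less_imp_neq[symmetric])

lemma period_pos:
  assumes "0 < c" "- (c\<^sup>2 / 2) < \<sigma>"
  shows "0 < period c \<sigma>"
proof -
  have "integral {0..2 * pi} (\<lambda>t. 0) < period c \<sigma>"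
    unfolding period_def
    by (rule integral_less_real)
      (auto intro!: continuous_on_period_integrand[OF assms] period_density_pos[OF assms(1)]
        period_radicand_pos[OF assms] simp: not_le pi_gt_zero)
  then show ?thesis by simp
qed

lemma period_powr_mean_le:
  assumes c: "0 < c" and xy: "- (c\<^sup>2 / 2) < x" "- (c\<^sup>2 / 2) < y" and l: "0 \<le> l" "l \<le> 1"
  shows "period c (l * x + (1 - l) * y) \<le> period c x powr l * period c y powr (1 - l)"
proof -
  have z: "- (c\<^sup>2 / 2) < l * x + (1 - l) * y"
    using convexD[of "{- (c\<^sup>2 / 2)<..}" x y l "1 - l"] xy l by (simp add: convex_real_interval)
  show ?thesis
    unfolding period_def
  proof (rule integral_powr_mean_le)
    fix t
    have "c\<^sup>2 + 2 * (l * x + (1 - l) * y) * (cos t)\<^sup>2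
        = l * (c\<^sup>2 + 2 * x * (cos t)\<^sup>2) + (1 - l) * (c\<^sup>2 + 2 * y * (cos t)\<^sup>2)"
      by (simp add: algebra_simps)
    then show "period_density c (c\<^sup>2 + 2 * (l * x + (1 - l) * y) * (cos t)\<^sup>2)
        \<le> period_density c (c\<^sup>2 + 2 * x * (cos t)\<^sup>2) powr l
          * period_density c (c\<^sup>2 + 2 * y * (cos t)\<^sup>2) powr (1 - l)"
      using period_density_powr_mean_le[OF c _ _ l] period_radicand_pos[OF c] xy by simp
    show "0 < period_density c (c\<^sup>2 + 2 * x * (cos t)\<^sup>2)"
      "0 < period_density c (c\<^sup>2 + 2 * y * (cos t)\<^sup>2)"
      by (intro period_density_pos period_radicand_pos c xy)+
  qed (simp_all only: continuous_on_period_integrand[OF c xy(1)]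
      continuous_on_period_integrand[OF c xy(2)] continuous_on_period_integrand[OF c z] l zero_less_mult_iff
      pi_gt_zero zero_less_numeral simp_thms)
qed

text \<open>For a log-convex function, the product of two values with prescribed sum of arguments grows as the
  arguments move apart.\<close>

lemma period_mult_le:
  assumes c: "0 < c" and a: "- (c\<^sup>2 / 2) < a" and b: "a \<le> x" "x \<le> b" and xy: "x + y = a + b"
  shows "period c x * period c y \<le> period c a * period c b"
proof (cases "a = b")
  case True
  then show ?thesis using b xy by simp
next
  case False
  then have ab: "a < b" using b by simp
  \<comment> \<open>The weights expressing $x$, and with exchanged roles $y$, as means of $a$ and $b$.\<close>
  define l where "l = (b - x) / (b - a)"
  have l: "0 \<le> l" "l \<le> 1" using ab b by (auto simp: l_def field_simps)
  have "l * (b - a) = b - x" using ab by (simp add: l_def)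
  then have x: "x = l * a + (1 - l) * b" and y: "y = (1 - l) * a + (1 - (1 - l)) * b"
    using xy by (auto simp: algebra_simps)
  have p: "0 < period c a" "0 < period c b" using period_pos[OF c] a ab by auto
  have "period c x \<le> period c a powr l * period c b powr (1 - l)"
    unfolding x by (rule period_powr_mean_le[OF c a _ l]) (use a ab in linarith)
  moreover have "period c y \<le> period c a powr (1 - l) * period c b powr (1 - (1 - l))"
    unfolding y by (rule period_powr_mean_le[OF c a]) (use a ab l in linarith)+
  moreover have "0 \<le> period c y"
    using period_pos[OF c, of y] xy b a ab by (intro less_imp_le) auto
  ultimately have "period c x * period c y \<le>
      (period c a powr l * period c b powr (1 - l)) *
      (period c a powr (1 - l) * period c b powr (1 - (1 - l)))"
    by (intro mult_mono) auto
  also have "\<dots> = (period c a powr (l + (1 - l))) * (period c b powr ((1 - l) + (1 - (1 - l))))"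
    by (simp only: powr_add mult_ac)
  also have "\<dots> = period c a * period c b" using p by simp
  finally show ?thesis .
qed

section \<open>The profile of the toric domain\<close>

text \<open>Differentiability is only required in the interior; the mean value theorem brings in the end points.\<close>

lemma convex_on_interval_derivI:
  fixes f f' :: "real \<Rightarrow> real"
  assumes cont: "continuous_on {a..b} f"
    and D: "\<And>x. a < x \<Longrightarrow> x < b \<Longrightarrow> (f has_real_derivative f' x) (at x)"
    and mono: "\<And>x y. a < x \<Longrightarrow> x < y \<Longrightarrow> y < b \<Longrightarrow> f' x \<le> f' y"
  shows "convex_on {a..b} f"
proof (rule convex_on_linorderI)
  fix t x y :: real
  assume t: "0 < t" "t < 1" and xy: "x \<in> {a..b}" "y \<in> {a..b}" "x < y"
  define z where "z = (1 - t) * x + t * y"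
  have zx: "z - x = t * (y - x)" and yz: "y - z = (1 - t) * (y - x)"
    by (simp_all add: z_def algebra_simps)
  have "0 < z - x" "0 < y - z" unfolding zx yz using t xy by simp_all
  then have z: "x < z" "z < y" by simp_all
  have mvt: "\<exists>w. p < w \<and> w < q \<and> f q - f p = (q - p) * f' w"
    if "p < q" "a \<le> p" "q \<le> b" for p q
  proof -
    have "\<exists>l w. p < w \<and> w < q \<and> (f has_real_derivative l) (at w) \<and> f q - f p = (q - p) * l"
    proof (rule MVT[OF that(1)])
      show "continuous_on {p..q} f" by (rule continuous_on_subset[OF cont]) (use that in auto)
      show "f differentiable (at w)" if "p < w" "w < q" for w
        using D[of w] that \<open>a \<le> p\<close> \<open>q \<le> b\<close> by (auto simp: real_differentiable_def)
    qed
    then obtain l w where w: "p < w" "w < q" "(f has_real_derivative l) (at w)"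
      "f q - f p = (q - p) * l" by blast
    have "l = f' w" by (rule DERIV_unique[OF w(3) D]) (use w that in auto)
    with w show ?thesis by blast
  qed
  obtain v where v: "x < v" "v < z" "f z - f x = (z - x) * f' v" using mvt[of x z] z xy by auto
  obtain w where w: "z < w" "w < y" "f y - f z = (y - z) * f' w" using mvt[of z y] z xy by auto
  have "f' v \<le> f' w" using mono[of v w] v w xy by auto
  then have "(t * (1 - t) * (y - x)) * f' v \<le> (t * (1 - t) * (y - x)) * f' w"
    using t xy by (intro mult_left_mono) auto
  moreover have "(t * (1 - t) * (y - x)) * f' v = (1 - t) * (f z - f x)"
    "(t * (1 - t) * (y - x)) * f' w = t * (f y - f z)"
    unfolding v(3) w(3) zx yz by simp_all
  ultimately have "(1 - t) * (f z - f x) \<le> t * (f y - f z)" by linarith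
  then have "f z \<le> (1 - t) * f x + t * f y" by (simp add: algebra_simps)
  then show "f ((1 - t) *\<^sub>R x + t *\<^sub>R y) \<le> (1 - t) * f x + t * f y" by (simp add: z_def)
qed simp


text \<open>Points strictly below the graph are interior, and a point over the graph leaves the domain when it is
  scaled up slightly, because $f$ is strictly decreasing.\<close>

lemma frontier_toric_domain:
  fixes f :: "real \<Rightarrow> real"
  assumes a: "0 < a" and f: "strict_antimono_on {0..a} f" "continuous_on {0..a} f" "f a = 0"
  shows "frontier (toric_domain {(x, y). 0 \<le> x \<and> x \<le> a \<and> 0 \<le> y \<and> y \<le> f x}) =
    {(u1, u2). pi * (cmod u1)\<^sup>2 \<le> a \<and> pi * (cmod u2)\<^sup>2 = f (pi * (cmod u1)\<^sup>2)}"
    (is "frontier ?X = ?G")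
proof -
  have anti: "f y < f x" if "0 \<le> x" "x < y" "y \<le> a" for x y
    using f(1) that unfolding monotone_on_def by auto
  \<comment> \<open>A continuous extension of $f$ to the whole line.\<close>
  define F where "F x = f (max 0 (min a x))" for x
  have F: "F x = f x" if "0 \<le> x" "x \<le> a" for x using that by (simp add: F_def)
  have cF: "continuous_on UNIV F"
    unfolding F_def[abs_def]
    by (rule continuous_on_compose2[OF f(2)]) (use a in \<open>auto intro!: continuous_intros\<close>)
  have X: "?X = {p. pi * (cmod (fst p))\<^sup>2 \<le> a \<and> pi * (cmod (snd p))\<^sup>2 \<le> F (pi * (cmod (fst p))\<^sup>2)}"
    by (auto simp: toric_domain_def F)
  have cl: "closed ?X"
    unfolding X
    by (intro closed_Collect_conj closed_Collect_le continuous_intros continuous_on_compose2[OF cF]) auto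
  let ?I = "{p. pi * (cmod (fst p))\<^sup>2 < a \<and> pi * (cmod (snd p))\<^sup>2 < F (pi * (cmod (fst p))\<^sup>2)}"
  have "open ?I"
    by (intro open_Collect_conj open_Collect_less continuous_intros continuous_on_compose2[OF cF]) auto
  then have int: "?I \<subseteq> interior ?X"
    by (rule interior_maximal[rotated]) (auto simp: X)
  show ?thesis
  proof (intro equalityI subsetI)
    fix p assume "p \<in> frontier ?X"
    then have p: "p \<in> ?X" "p \<notin> ?I" using cl int by (auto simp: frontier_def)
    obtain u1 u2 where u: "p = (u1, u2)" by (cases p)
    let ?x = "pi * (cmod u1)\<^sup>2" and ?y = "pi * (cmod u2)\<^sup>2"
    have xy: "0 \<le> ?x" "0 \<le> ?y" by simp_all
    have le: "?x \<le> a" "?y \<le> f ?x" using p(1) by (auto simp: u toric_domain_def)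
    have "\<not> (?x < a \<and> ?y < f ?x)" using p(2) F[OF xy(1) le(1)] by (simp add: u)
    then have "?y = f ?x" using le xy f(3) by (cases "?x = a") auto
    then show "p \<in> ?G" using le by (simp add: u)
  next
    fix p assume p: "p \<in> ?G"
    obtain u1 u2 where u: "p = (u1, u2)" by (cases p)
    let ?x = "pi * (cmod u1)\<^sup>2" and ?y = "pi * (cmod u2)\<^sup>2"
    have nonneg: "0 \<le> ?x" "0 \<le> ?y" by simp_all
    have "?x \<le> a" "?y = f ?x" using p by (simp_all add: u)
    with nonneg have x: "0 \<le> ?x" "?x \<le> a" and y: "0 \<le> ?y" "?y = f ?x" by blast+
    have pX: "p \<in> ?X" unfolding u toric_domain_def mem_Collect_eq case_prod_conv using x y by linarith
    have "p \<notin> interior ?X"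
    proof
      assume "p \<in> interior ?X"
      then obtain e where e: "0 < e" "ball p e \<subseteq> ?X" by (auto simp: mem_interior)
      define d where "d = (e / 2) / (norm p + 1)"
      have np: "0 < norm p + 1" by (simp add: add_nonneg_pos)
      have d: "0 < d" using e(1) np by (simp add: d_def)
      have "d * (norm p + 1) = e / 2"
        unfolding d_def using np by (metis less_irrefl nonzero_eq_divide_eq)
      then have dn: "d * norm p < e" using e(1) d by (simp add: distrib_left)
      have "dist p ((1 + d) *\<^sub>R p) = d * norm p"
      proof -
        have "p - (1 + d) *\<^sub>R p = - (d *\<^sub>R p)" by (simp add: algebra_simps)
        then show ?thesis using d by (simp add: dist_norm)
      qed
      then have "(1 + d) *\<^sub>R p \<in> ?X" using e(2) dn by auto
      moreover have sc: "pi * (cmod ((1 + d) *\<^sub>R w))\<^sup>2 = (1 + d)\<^sup>2 * (pi * (cmod w)\<^sup>2)" for w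
        by (simp add: power_mult_distrib)
      ultimately have X': "(1 + d)\<^sup>2 * ?x \<le> a" "(1 + d)\<^sup>2 * ?y \<le> f ((1 + d)\<^sup>2 * ?x)"
        unfolding u scaleR_Pair toric_domain_def by (simp_all only: mem_Collect_eq case_prod_conv sc)
      have s: "1 < (1 + d)\<^sup>2" using d by (simp add: one_less_power)
      then have ge: "?y \<le> (1 + d)\<^sup>2 * ?y" using y(1) mult_right_mono[of 1 "(1 + d)\<^sup>2" ?y] by simp
      show False
      proof (cases "?x = 0")
        case True
        then have "0 < ?y" using y(2) anti[of 0 a] a f(3) by simp
        then have "?y < (1 + d)\<^sup>2 * ?y" using s mult_strict_right_mono[of 1 "(1 + d)\<^sup>2" ?y] by simp
        moreover have "(1 + d)\<^sup>2 * ?y \<le> ?y" using X'(2) y(2) True by simp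
        ultimately show False by linarith
      next
        case False
        then have "?x < (1 + d)\<^sup>2 * ?x"
          using s x mult_strict_right_mono[of 1 "(1 + d)\<^sup>2" ?x] by simp
        then have "f ((1 + d)\<^sup>2 * ?x) < f ?x" by (rule anti[OF x(1) _ X'(1)])
        then show False using X'(2) ge y(2) by linarith
      qed
    qed
    then show "p \<in> frontier ?X" using pX cl by (simp add: frontier_def)
  qed
qed

text \<open>Here $c=-h$. The condition $4\varepsilon<c^2$ is the assumption that the energy lies below the critical value.
  The first well is the hardening one, with coefficient $\varepsilon$, and the second the softening one, with
  coefficient $-\varepsilon$.\<close>

locale stark_below_critical =
  fixes \<epsilon> c :: real
  assumes field_pos: "0 < \<epsilon>" and energy_pos: "0 < c" and below_critical: "4 * \<epsilon> < c\<^sup>2"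
begin

lemma radius_sq: "(c / sqrt \<epsilon>)\<^sup>2 = c\<^sup>2 / \<epsilon>"
  using field_pos by (simp add: power_divide)

sublocale W1: quartic_well c \<epsilon> "c / sqrt \<epsilon>"
  using field_pos energy_pos by unfold_locales (simp_all add: radius_sq)

sublocale W2: quartic_well c "- \<epsilon>" "c / sqrt \<epsilon>"
  using field_pos energy_pos by unfold_locales (simp_all add: radius_sq)

text \<open>The level $2$ lies below the barrier of the softening well.\<close>

lemma two_less_max_energy: "2 < (c / sqrt \<epsilon>)\<^sup>2 / 2"
  using field_pos below_critical by (simp add: radius_sq field_simps)

text \<open>The inverse of the action of the first well on the energies between $0$ and $2$.\<close>

definition energy_of_action :: "real \<Rightarrow> real" where
  "energy_of_action = the_inv_into {0..2} W1.action"

text \<open>The function $f$ bounding the toric domain: given the action of the first well, the action of the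
  second well at the complementary energy.\<close>

definition profile :: "real \<Rightarrow> real" where
  "profile x = W2.action (2 - energy_of_action x)"

lemma inj_on_action: "inj_on W1.action {0..2}"
  using W1.action_strict_mono two_less_max_energy
  by (intro linorder_inj_onI) (force simp: order.strict_iff_order)+

lemma energy_of_action_action: "e \<in> {0..2} \<Longrightarrow> energy_of_action (W1.action e) = e"
  unfolding energy_of_action_def by (rule the_inv_into_f_f[OF inj_on_action])

lemma W1_action_nonneg: "0 \<le> e \<Longrightarrow> e \<le> 2 \<Longrightarrow> 0 \<le> W1.action e"
  using W1.action_strict_mono[of 0 e] two_less_max_energy W1.action_0 by (cases "e = 0") auto

lemma W2_action_nonneg: "0 \<le> e \<Longrightarrow> e \<le> 2 \<Longrightarrow> 0 \<le> W2.action e"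
  using W2.action_strict_mono[of 0 e] two_less_max_energy W2.action_0 by (cases "e = 0") auto

lemma continuous_on_actions:
  "continuous_on {0..2} W1.action" "continuous_on {0..2} W2.action"
  using two_less_max_energy
  by (auto intro: continuous_on_subset[OF W1.continuous_on_action] continuous_on_subset[OF W2.continuous_on_action])

lemma W1_action_mono: "0 \<le> e \<Longrightarrow> e \<le> e' \<Longrightarrow> e' \<le> 2 \<Longrightarrow> W1.action e \<le> W1.action e'"
  using W1.action_strict_mono[of e e'] two_less_max_energy by (cases "e = e'") auto

lemma W1_action_image: "W1.action ` {0..2} = {0..W1.action 2}"
proof (intro equalityI subsetI)
  fix x assume "x \<in> W1.action ` {0..2}"
  then show "x \<in> {0..W1.action 2}" using W1_action_mono W1_action_nonneg by auto
next
  fix x assume "x \<in> {0..W1.action 2}"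
  then show "x \<in> W1.action ` {0..2}"
    using IVT'[of W1.action 0 x 2] continuous_on_actions(1) W1.action_0 by force
qed

lemma action_cases:
  assumes "x \<in> {0..W1.action 2}"
  obtains e where "e \<in> {0..2}" "x = W1.action e" "energy_of_action x = e"
  using assms energy_of_action_action unfolding W1_action_image[symmetric] by blast

lemma action_less_iff:
  "e \<in> {0..2} \<Longrightarrow> e' \<in> {0..2} \<Longrightarrow> W1.action e < W1.action e' \<longleftrightarrow> e < e'"
  using W1.action_strict_mono[of e e'] W1_action_mono[of e' e] two_less_max_energy by force

lemma continuous_on_energy_of_action: "continuous_on {0..W1.action 2} energy_of_action"
  unfolding energy_of_action_def W1_action_image[symmetric]
  by (intro continuous_on_inv_into continuous_on_actions inj_on_action) simp

lemma continuous_on_profile: "continuous_on {0..W1.action 2} profile"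
  unfolding profile_def[abs_def]
  by (intro continuous_on_compose2[OF continuous_on_actions(2)] continuous_intros
      continuous_on_energy_of_action)
    (auto elim!: action_cases[unfolded atLeastAtMost_iff])

lemma profile_action: "e \<in> {0..2} \<Longrightarrow> profile (W1.action e) = W2.action (2 - e)"
  by (simp add: profile_def energy_of_action_action)

lemma strict_antimono_profile: "strict_antimono_on {0..W1.action 2} profile"
proof (rule monotone_onI)
  fix x y assume xy: "x \<in> {0..W1.action 2}" "y \<in> {0..W1.action 2}" "x < y"
  obtain d where d: "d \<in> {0..2}" "x = W1.action d" "energy_of_action x = d"
    by (rule action_cases[OF xy(1)])
  obtain e where e: "e \<in> {0..2}" "y = W1.action e" "energy_of_action y = e"
    by (rule action_cases[OF xy(2)])
  have "d < e" using xy(3) action_less_iff[OF d(1) e(1)] d e by simp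
  then have "W2.action (2 - e) < W2.action (2 - d)"
    using d e two_less_max_energy by (intro W2.action_strict_mono) auto
  then show "profile y < profile x" using d e by (simp add: profile_action)
qed

lemma period_pos_of_nonneg_energy:
  assumes "0 \<le> e"
  shows "0 < period c (\<epsilon> * e)"
proof -
  have "0 \<le> \<epsilon> * e" using assms field_pos by simp
  moreover have "0 < c\<^sup>2 / 2" using energy_pos by simp
  ultimately show ?thesis by (intro period_pos energy_pos) linarith
qed

lemma profile_has_derivative:
  assumes x: "0 < x" "x < W1.action 2"
  defines "e \<equiv> energy_of_action x"
  shows "(profile has_real_derivative - (period c (\<epsilon> * (e - 2)) / period c (\<epsilon> * e))) (at x)"
proof -
  have "x \<in> {0..W1.action 2}" using x by auto
  then have e: "e \<in> {0..2}" "x = W1.action e" unfolding e_def by (rule action_cases; simp)+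
  have e02: "0 < e" "e < 2" using e x W1.action_0 by (auto simp: less_le)
  have pos: "0 < period c (\<epsilon> * e)" using e02 by (intro period_pos_of_nonneg_energy) simp
  have "isCont energy_of_action x"
    using continuous_on_interior[OF continuous_on_energy_of_action, of x] x
    by simp
  moreover have "W1.action (energy_of_action y) = y" if "0 < y" "y < W1.action 2" for y
  proof -
    have "y \<in> {0..W1.action 2}" using that by auto
    then show ?thesis by (rule action_cases) simp
  qed
  moreover have "(W1.action has_real_derivative period c (\<epsilon> * e)) (at (energy_of_action x))"
    using W1.action_has_derivative[of e] e02 two_less_max_energy by (simp add: e_def)
  ultimately have E: "(energy_of_action has_real_derivative inverse (period c (\<epsilon> * e))) (at x)"
    using pos x by (intro DERIV_inverse_function[where f=W1.action and a=0 and b="W1.action 2"]) auto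
  have "((\<lambda>x. 2 - energy_of_action x) has_real_derivative - inverse (period c (\<epsilon> * e))) (at x)"
    using DERIV_diff[OF DERIV_const E, of 2] by simp
  moreover have "(W2.action has_real_derivative period c (- \<epsilon> * (2 - e))) (at (2 - energy_of_action x))"
    using W2.action_has_derivative[of "2 - e"] e02 two_less_max_energy by (simp add: e_def)
  ultimately have "(profile has_real_derivative
      period c (- \<epsilon> * (2 - e)) * - inverse (period c (\<epsilon> * e))) (at x)"
    unfolding profile_def[abs_def] by (intro DERIV_chain2[where g="\<lambda>x. 2 - energy_of_action x"])
  moreover have "- \<epsilon> * (2 - e) = \<epsilon> * (e - 2)" by (simp add: algebra_simps)
  ultimately show ?thesis by (simp add: divide_inverse)
qed

text \<open>For $d<e$ the slopes compare by \<open>period_mult_le\<close>, since $\varepsilon(d-2)$ and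
  $\varepsilon e$ have the same sum as $\varepsilon(e-2)$ and $\varepsilon d$ and lie further apart.\<close>

lemma convex_on_profile: "convex_on {0..W1.action 2} profile"
proof (rule convex_on_interval_derivI[OF continuous_on_profile profile_has_derivative])
  fix x y assume xy: "0 < x" "x < y" "y < W1.action 2"
  have x: "x \<in> {0..W1.action 2}" and y: "y \<in> {0..W1.action 2}" using xy by auto
  obtain d where d: "d \<in> {0..2}" "x = W1.action d" "energy_of_action x = d"
    by (rule action_cases[OF x])
  obtain e where e: "e \<in> {0..2}" "y = W1.action e" "energy_of_action y = e"
    by (rule action_cases[OF y])
  have de: "d < e" using xy(2) action_less_iff[OF d(1) e(1)] d e by simp
  have d0: "0 < d" using d xy W1.action_0 by (auto simp: less_le)
  have "\<epsilon> * (- 2) < \<epsilon> * (d - 2)" using field_pos d0 by (intro mult_strict_left_mono) auto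
  then have lb: "- (c\<^sup>2 / 2) < \<epsilon> * (d - 2)" using below_critical by linarith
  have pos: "0 < period c (\<epsilon> * d)" "0 < period c (\<epsilon> * e)"
    using d0 de by (auto intro: period_pos_of_nonneg_energy)
  have "period c (\<epsilon> * (e - 2)) * period c (\<epsilon> * d) \<le> period c (\<epsilon> * (d - 2)) * period c (\<epsilon> * e)"
    using field_pos de d e
    by (intro period_mult_le[OF energy_pos lb]) (auto simp: algebra_simps)
  then have "period c (\<epsilon> * (e - 2)) / period c (\<epsilon> * e) \<le> period c (\<epsilon> * (d - 2)) / period c (\<epsilon> * d)"
    using pos by (simp add: field_simps)
  then show "- (period c (\<epsilon> * (energy_of_action x - 2)) / period c (\<epsilon> * energy_of_action x))
      \<le> - (period c (\<epsilon> * (energy_of_action y - 2)) / period c (\<epsilon> * energy_of_action y))"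
    unfolding d(3) e(3) by simp
qed

text \<open>The concave toric domain whose boundary is the image of the bounded component.\<close>

definition stark_toric_domain :: "(complex \<times> complex) set" where
  "stark_toric_domain =
    toric_domain {(x, y). 0 \<le> x \<and> x \<le> W1.action 2 \<and> 0 \<le> y \<and> y \<le> profile x}"

lemma action_2_pos: "0 < W1.action 2" "0 < W2.action 2"
  using W1.action_strict_mono[of 0 2] W2.action_strict_mono[of 0 2] two_less_max_energy W1.action_0 W2.action_0
  by auto

lemma profile_ends: "profile 0 = W2.action 2" "profile (W1.action 2) = 0"
  using profile_action[of 0] profile_action[of 2] W1.action_0 W2.action_0 by auto

lemma concave_toric_domain_stark: "concave_toric_domain stark_toric_domain"
proof -
  have "profile x \<in> {0..W2.action 2}" if x: "x \<in> {0..W1.action 2}" for x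
  proof -
    obtain e where e: "e \<in> {0..2}" "x = W1.action e" "energy_of_action x = e"
      by (rule action_cases[OF x])
    have "W2.action (2 - e) \<le> W2.action 2"
      using W2.action_strict_mono[of "2 - e" 2] e two_less_max_energy by (cases "e = 0") auto
    then show ?thesis using e W2_action_nonneg[of "2 - e"] by (simp add: profile_action)
  qed
  then show ?thesis
    unfolding concave_toric_domain_def stark_toric_domain_def
    using action_2_pos profile_ends convex_on_profile strict_antimono_profile continuous_on_profile
    by blast
qed

lemma frontier_stark_toric_domain:
  "frontier stark_toric_domain = {(u1, u2). \<exists>e\<in>{0..2}.
    pi * (cmod u1)\<^sup>2 = W1.action e \<and> pi * (cmod u2)\<^sup>2 = W2.action (2 - e)}"
proof -
  have *: "x \<le> W1.action 2 \<and> y = profile x \<longleftrightarrow>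
      (\<exists>e\<in>{0..2}. x = W1.action e \<and> y = W2.action (2 - e))" if "0 \<le> x" for x y
  proof
    assume xy: "x \<le> W1.action 2 \<and> y = profile x"
    have "x \<in> {0..W1.action 2}" using xy that by simp
    then obtain e where "e \<in> {0..2}" "x = W1.action e" "energy_of_action x = e"
      by (rule action_cases)
    then show "\<exists>e\<in>{0..2}. x = W1.action e \<and> y = W2.action (2 - e)"
      using xy profile_action by blast
  next
    assume "\<exists>e\<in>{0..2}. x = W1.action e \<and> y = W2.action (2 - e)"
    then show "x \<le> W1.action 2 \<and> y = profile x"
      using W1_action_mono profile_action by auto
  qed
  show ?thesis
    unfolding stark_toric_domain_def
      frontier_toric_domain[OF action_2_pos(1) strict_antimono_profile continuous_on_profile profile_ends(2)]
    by (simp add: *)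
qed

end


section \<open>The bounded component of the energy hypersurface\<close>

text \<open>The conjugate pair $(z_1,w_1)$ of a point $(z,w)$ of the cotangent bundle, as a complex number.\<close>

definition first_pair :: "complex \<times> complex \<Rightarrow> complex" where
  "first_pair p = Complex (Re (fst p)) (Re (snd p))"

text \<open>The conjugate pair $(z_2,w_2)$.\<close>

definition second_pair :: "complex \<times> complex \<Rightarrow> complex" where
  "second_pair p = Complex (Im (fst p)) (Im (snd p))"

text \<open>The point of the cotangent bundle with given conjugate pairs.\<close>

definition join_pairs :: "complex \<Rightarrow> complex \<Rightarrow> complex \<times> complex" where
  "join_pairs a b = (Complex (Re a) (Re b), Complex (Im a) (Im b))"

lemma join_pairs_simps [simp]:
  "first_pair (join_pairs a b) = a" "second_pair (join_pairs a b) = b"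
  "join_pairs (first_pair p) (second_pair p) = p"
  by (simp_all add: first_pair_def second_pair_def join_pairs_def complex_eq_iff prod_eq_iff)

lemma bounded_linear_pairs: "bounded_linear first_pair" "bounded_linear second_pair"
proof -
  have "linear first_pair" "linear second_pair"
    by (auto intro!: linearI simp: first_pair_def second_pair_def complex_eq_iff)
  then show "bounded_linear first_pair" "bounded_linear second_pair"
    by (simp_all add: linear_conv_bounded_linear)
qed

lemma continuous_on_join_pairs:
  assumes "continuous_on S f" "continuous_on S g"
  shows "continuous_on S (\<lambda>x. join_pairs (f x) (g x))"
  unfolding join_pairs_def Complex_eq by (intro continuous_intros assms)

lemma omega_cotangent_pairs:
  "omega_cotangent v v' = area_form (first_pair v) (first_pair v')
    + area_form (second_pair v) (second_pair v')"
  by (cases v; cases v') (simp add: omega_cotangent_eq_area_form first_pair_def second_pair_def)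

context stark_below_critical begin

abbreviation hypersurface :: "(complex \<times> complex) set" where
  "hypersurface \<equiv> regularized_hypersurface \<epsilon> (- c)"

text \<open>The points of the hypersurface with $z_2$ between the two barriers $z_2=\pm\sqrt{c/\varepsilon}$; it turns out
  to be the bounded component.\<close>

definition inner_part :: "(complex \<times> complex) set" where
  "inner_part = {p \<in> hypersurface. \<epsilon> * (Im (fst p))\<^sup>2 < c}"

lemma mem_hypersurface:
  "p \<in> hypersurface \<longleftrightarrow> W1.well_energy (first_pair p) + W2.well_energy (second_pair p) = 2"
  by (cases p) (auto simp: regularized_hypersurface_def regularized_energy_def
      W1.well_energy_def W2.well_energy_def first_pair_def second_pair_def)

lemma W1_energy_nonneg: "0 \<le> W1.well_energy u"
  using field_pos energy_pos by (simp add: W1.well_energy_def)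

lemma W2_energy_eq:
  "W2.well_energy u = (Im u)\<^sup>2 / 2 + (Re u)\<^sup>2 * (c - \<epsilon> / 2 * (Re u)\<^sup>2)"
  by (simp add: W2.well_energy_def power4_eq_xxxx power2_eq_square algebra_simps)

lemma W2_energy_nonneg: "\<epsilon> * (Re u)\<^sup>2 \<le> c \<Longrightarrow> 0 \<le> W2.well_energy u"
  using energy_pos unfolding W2_energy_eq by (intro add_nonneg_nonneg mult_nonneg_nonneg) auto

lemma hypersurface_gap:
  assumes "p \<in> hypersurface"
  shows "\<epsilon> * (Im (fst p))\<^sup>2 \<noteq> c"
proof
  assume eq: "\<epsilon> * (Im (fst p))\<^sup>2 = c"
  have "(Im (fst p))\<^sup>2 = c / \<epsilon>" using eq field_pos by (simp add: field_simps)
  then have "W2.well_energy (second_pair p) = (Im (snd p))\<^sup>2 / 2 + c / \<epsilon> * (c / 2)"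
    using eq unfolding W2_energy_eq by (simp add: second_pair_def)
  moreover have "2 < c / \<epsilon> * (c / 2)"
    using two_less_max_energy field_pos by (simp add: radius_sq power2_eq_square)
  ultimately have "2 < W2.well_energy (second_pair p)" by (smt (verit) zero_le_power2 divide_nonneg_pos)
  then show False using assms W1_energy_nonneg[of "first_pair p"] by (simp add: mem_hypersurface)
qed

text \<open>The product of the two wells, an open set meeting the hypersurface exactly in the inner part.\<close>

definition chart_domain :: "(complex \<times> complex) set" where
  "chart_domain = {p. first_pair p \<in> W1.well \<and> second_pair p \<in> W2.well}"

lemma inner_part_eq: "inner_part = hypersurface \<inter> chart_domain"
proof (intro equalityI subsetI)
  fix p assume p: "p \<in> inner_part"
  then have h: "p \<in> hypersurface" and lt: "\<epsilon> * (Re (second_pair p))\<^sup>2 < c"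
    by (auto simp: inner_part_def second_pair_def)
  have "0 \<le> W1.well_energy (first_pair p)" "0 \<le> W2.well_energy (second_pair p)"
    using W1_energy_nonneg W2_energy_nonneg lt by auto
  moreover have "0 < c + \<epsilon> * (Re (first_pair p))\<^sup>2"
    using energy_pos field_pos by (intro add_pos_nonneg) auto
  ultimately show "p \<in> hypersurface \<inter> chart_domain"
    using h lt two_less_max_energy by (auto simp: chart_domain_def W1.well_def W2.well_def mem_hypersurface)
next
  fix p assume "p \<in> hypersurface \<inter> chart_domain"
  then show "p \<in> inner_part"
    by (auto simp: inner_part_def chart_domain_def W2.well_def second_pair_def)
qed

text \<open>Parametrization of the inner part by the energy of the first well and one angle in each well. It
  shows that the inner part is compact and connected.\<close>

definition inner_param :: "real \<times> real \<times> real \<Rightarrow> complex \<times> complex" where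
  "inner_param = (\<lambda>(e, \<alpha>, \<beta>). join_pairs (W1.unflat (of_real (sqrt (2 * e)) * cis \<alpha>))
    (W2.unflat (of_real (sqrt (2 * (2 - e))) * cis \<beta>)))"

lemma energy_circle_in_ball:
  assumes "0 \<le> e" "e \<le> 2"
  shows "of_real (sqrt (2 * e)) * cis \<alpha> \<in> ball 0 (c / sqrt \<epsilon>)"
  using W1.sqrt_energy[of e] assms two_less_max_energy by (simp add: norm_mult)

lemma inner_param_image: "inner_param ` ({0..2} \<times> {0..2 * pi} \<times> {0..2 * pi}) = inner_part"
proof (intro equalityI subsetI)
  fix p assume "p \<in> inner_param ` ({0..2} \<times> {0..2 * pi} \<times> {0..2 * pi})"
  then obtain e \<alpha> \<beta> where e: "0 \<le> e" "e \<le> 2" and p: "p = inner_param (e, \<alpha>, \<beta>)" by auto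
  have b: "of_real (sqrt (2 * e)) * cis \<alpha> \<in> ball 0 (c / sqrt \<epsilon>)"
    "of_real (sqrt (2 * (2 - e))) * cis \<beta> \<in> ball 0 (c / sqrt \<epsilon>)"
    using e by (intro energy_circle_in_ball; simp)+
  have "p \<in> chart_domain" using W1.unflat(1)[OF b(1)] W2.unflat(1)[OF b(2)]
    by (simp add: p inner_param_def chart_domain_def)
  moreover have "p \<in> hypersurface" using W1.unflat(3)[OF b(1)] W2.unflat(3)[OF b(2)] e
    by (simp add: p inner_param_def mem_hypersurface norm_mult)
  ultimately show "p \<in> inner_part" by (simp add: inner_part_eq)
next
  fix p assume "p \<in> inner_part"
  then have p: "p \<in> hypersurface" "first_pair p \<in> W1.well" "second_pair p \<in> W2.well"
    by (auto simp: inner_part_eq chart_domain_def)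
  define e where "e = W1.well_energy (first_pair p)"
  have e2: "W2.well_energy (second_pair p) = 2 - e" using p(1) by (simp add: e_def mem_hypersurface)
  have e: "0 \<le> e" "e \<le> 2"
    using W1.well_energy_nonneg[OF p(2)] W2.well_energy_nonneg[OF p(3)] e2 by (auto simp: e_def)
  have n1: "cmod (W1.flat (first_pair p)) = sqrt (2 * e)"
    using W1.cmod_flat[of "first_pair p"] p(2) by (simp add: e_def W1.well_def real_sqrt_unique)
  have n2: "cmod (W2.flat (second_pair p)) = sqrt (2 * (2 - e))"
    using W2.cmod_flat[of "second_pair p"] p(3) unfolding e2[symmetric]
    by (simp add: W2.well_def real_sqrt_unique)
  obtain \<alpha> where \<alpha>: "0 \<le> \<alpha>" "\<alpha> < 2 * pi" "W1.flat (first_pair p) = of_real (sqrt (2 * e)) * cis \<alpha>"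
    unfolding n1[symmetric] by (rule W1.polar_form)
  obtain \<beta> where \<beta>: "0 \<le> \<beta>" "\<beta> < 2 * pi" "W2.flat (second_pair p) = of_real (sqrt (2 * (2 - e))) * cis \<beta>"
    unfolding n2[symmetric] by (rule W1.polar_form)
  have "p = inner_param (e, \<alpha>, \<beta>)"
    unfolding inner_param_def case_prod_conv \<alpha>(3)[symmetric] \<beta>(3)[symmetric]
    by (simp add: W1.unflat_flat[OF p(2)] W2.unflat_flat[OF p(3)])
  then show "p \<in> inner_param ` ({0..2} \<times> {0..2 * pi} \<times> {0..2 * pi})"
    using e \<alpha> \<beta> by (intro image_eqI[of _ _ "(e, \<alpha>, \<beta>)"]) auto
qed

lemma continuous_on_inner_param:
  "continuous_on ({0..2} \<times> {0..2 * pi} \<times> {0..2 * pi}) inner_param"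
  unfolding inner_param_def split_beta
proof (intro continuous_on_join_pairs continuous_on_compose2[OF W1.continuous_on_unflat]
    continuous_on_compose2[OF W2.continuous_on_unflat] continuous_intros image_subsetI)
  fix x :: "real \<times> real \<times> real" assume "x \<in> {0..2} \<times> {0..2 * pi} \<times> {0..2 * pi}"
  then have "0 \<le> fst x" "fst x \<le> 2" by auto
  then show "of_real (sqrt (2 * fst x)) * cis (fst (snd x)) \<in> ball 0 (c / sqrt \<epsilon>)"
    "of_real (sqrt (2 * (2 - fst x))) * cis (snd (snd x)) \<in> ball 0 (c / sqrt \<epsilon>)"
    by (intro energy_circle_in_ball; simp)+
qed

lemma connected_inner_part: "connected inner_part"
  unfolding inner_param_image[symmetric]
  by (intro connected_continuous_image continuous_on_inner_param connected_Times connected_Icc)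

lemma bounded_inner_part: "bounded inner_part"
  unfolding inner_param_image[symmetric]
  by (intro compact_imp_bounded compact_continuous_image continuous_on_inner_param compact_Times
      compact_Icc)

text \<open>No point of the hypersurface lies on a barrier, so the inner part is open and closed in it.\<close>

lemma inner_part_component: "inner_part \<in> components hypersurface"
  unfolding in_components_maximal
proof (intro conjI allI impI)
  have "inner_param (0, 0, 0) \<in> inner_part" unfolding inner_param_image[symmetric] by simp
  then show "inner_part \<noteq> {}" by blast
  show "inner_part \<subseteq> hypersurface" by (auto simp: inner_part_def)
  show "connected inner_part" by (rule connected_inner_part)
  fix d assume d: "d \<noteq> {} \<and> inner_part \<subseteq> d \<and> d \<subseteq> hypersurface \<and> connected d"
  let ?A = "{p :: complex \<times> complex. \<epsilon> * (Im (fst p))\<^sup>2 < c}"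
  let ?B = "{p :: complex \<times> complex. c < \<epsilon> * (Im (fst p))\<^sup>2}"
  have "open ?A" "open ?B" by (intro open_Collect_less continuous_intros)+
  moreover have "d \<subseteq> ?A \<union> ?B" using hypersurface_gap d by (force simp: less_le)
  moreover have "?A \<inter> ?B \<inter> d = {}" by auto
  moreover have "inner_part \<subseteq> ?A" by (auto simp: inner_part_def)
  then have "?A \<inter> d \<noteq> {}" using \<open>inner_part \<noteq> {}\<close> d by blast
  ultimately have "?B \<inter> d = {}" using connectedD[of d ?A ?B] d by blast
  then have "d \<subseteq> inner_part" using d \<open>d \<subseteq> ?A \<union> ?B\<close> by (auto simp: inner_part_def)
  then show "d = inner_part" using d by blast
qed

text \<open>Beyond the barrier, letting $|z_2|$ grow lowers the potential of the softening well without bound; the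
  energy is balanced by increasing $|w_1|$, all other coordinates staying fixed.\<close>

lemma outer_unbounded:
  assumes p: "p \<in> hypersurface" and out: "c < \<epsilon> * (Im (fst p))\<^sup>2"
  shows "\<exists>L. p \<in> L \<and> L \<subseteq> hypersurface \<and> connected L \<and> \<not> bounded L"
proof -
  obtain z w where pzw: "p = (z, w)" by (cases p)
  define y where "y = Im z"
  define V where "V x = x\<^sup>2 * (c - \<epsilon> / 2 * x\<^sup>2)" for x
  define \<sigma> :: real where "\<sigma> = (if Re w < 0 then - 1 else 1)"
  \<comment> \<open>The value of $w_1^2$ required once $z_2$ is multiplied by $s$.\<close>
  define K where "K s = (Re w)\<^sup>2 + 2 * (V y - V (s * y))" for s
  define \<gamma> where "\<gamma> s = (Complex (Re z) (s * y), Complex (\<sigma> * sqrt (K s)) (Im w))" for s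
  have out': "c < \<epsilon> * y\<^sup>2" using out by (simp add: pzw y_def)
  have y0: "y \<noteq> 0" using out' energy_pos by auto
  have \<sigma>: "\<sigma> * \<bar>Re w\<bar> = Re w" "\<sigma>\<^sup>2 = 1" by (auto simp: \<sigma>_def)
  have mem: "(Complex a b, Complex a' b') \<in> hypersurface \<longleftrightarrow>
      a'\<^sup>2 / 2 + c * a\<^sup>2 + \<epsilon> / 2 * a ^ 4 + (b'\<^sup>2 / 2 + V b) = 2" for a b a' b'
    unfolding mem_hypersurface W2_energy_eq
    by (simp add: W1.well_energy_def first_pair_def second_pair_def V_def)
  have h: "(Re w)\<^sup>2 / 2 + c * (Re z)\<^sup>2 + \<epsilon> / 2 * (Re z) ^ 4 + ((Im w)\<^sup>2 / 2 + V y) = 2"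
    using p mem[of "Re z" "Im z" "Re w" "Im w"] by (simp add: pzw y_def)
  have K: "0 \<le> K s" if "1 \<le> s" for s
  proof -
    have s2: "1 \<le> s\<^sup>2" using that by simp
    have "\<epsilon> / 2 * y\<^sup>2 * 2 \<le> \<epsilon> / 2 * y\<^sup>2 * (s\<^sup>2 + 1)"
      using field_pos s2 by (intro mult_left_mono) auto
    then have "0 \<le> (s\<^sup>2 - 1) * y\<^sup>2 * (\<epsilon> / 2 * y\<^sup>2 * (s\<^sup>2 + 1) - c)"
      using s2 out' by (intro mult_nonneg_nonneg) auto
    also have "\<dots> = V y - V (s * y)"
      by (simp add: V_def power2_eq_square field_simps)
    finally show ?thesis by (simp add: K_def)
  qed
  let ?L = "\<gamma> ` {1..}"
  have "\<gamma> 1 = p" using \<sigma>(1) by (simp add: \<gamma>_def K_def pzw y_def complex_eq_iff)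
  then have "p \<in> ?L" by (metis atLeast_iff image_eqI order_refl)
  moreover have "\<gamma> s \<in> hypersurface" if "1 \<le> s" for s
    unfolding \<gamma>_def mem using K[OF that] h
    by (simp add: power_mult_distrib \<sigma>(2)) (simp add: K_def add_divide_distrib diff_divide_distrib)
  then have "?L \<subseteq> hypersurface" by auto
  moreover have "connected ?L"
    unfolding \<gamma>_def[abs_def] K_def V_def Complex_eq
    by (intro connected_continuous_image continuous_intros) simp
  moreover have "\<not> bounded ?L"
  proof
    assume "bounded ?L"
    then obtain M where M: "\<And>s. 1 \<le> s \<Longrightarrow> norm (\<gamma> s) \<le> M" by (auto simp: bounded_iff)
    define s where "s = max 1 ((M + 1) / \<bar>y\<bar>)"
    have "M + 1 \<le> s * \<bar>y\<bar>" using y0 by (simp add: s_def pos_divide_le_eq[symmetric])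
    also have "\<dots> = \<bar>Im (fst (\<gamma> s))\<bar>" by (simp add: \<gamma>_def abs_mult s_def)
    also have "\<dots> \<le> cmod (fst (\<gamma> s))" by (rule abs_Im_le_cmod)
    also have "\<dots> \<le> norm (\<gamma> s)" by (metis norm_fst_le prod.collapse)
    also have "\<dots> \<le> M" by (rule M) (simp add: s_def)
    finally show False by simp
  qed
  ultimately show ?thesis by (intro exI[of _ ?L] conjI)
qed

lemma bounded_component_eq: "bounded_component \<epsilon> (- c) = inner_part"
  unfolding bounded_component_def
proof (rule the_equality)
  show "inner_part \<in> components hypersurface \<and> bounded inner_part"
    using inner_part_component bounded_inner_part by blast
  fix B assume B: "B \<in> components hypersurface \<and> bounded B"
  then obtain p where p: "p \<in> B" "p \<in> hypersurface"
    using in_components_nonempty in_components_subset by blast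
  have "\<not> c < \<epsilon> * (Im (fst p))\<^sup>2"
  proof
    assume "c < \<epsilon> * (Im (fst p))\<^sup>2"
    then obtain L where L: "p \<in> L" "L \<subseteq> hypersurface" "connected L" "\<not> bounded L"
      using outer_unbounded[OF p(2)] by blast
    then have "L \<subseteq> B" using B p by (intro components_maximal[of B hypersurface L]) auto
    then show False using L(4) B bounded_subset by blast
  qed
  then have "p \<in> inner_part" using hypersurface_gap[OF p(2)] p(2) by (auto simp: inner_part_def)
  then show "B = inner_part" using B p inner_part_component components_eq by blast
qed

section \<open>The symplectomorphism\<close>

text \<open>The product of the two well maps, each acting on its own conjugate pair.\<close>

definition chart :: "complex \<times> complex \<Rightarrow> complex \<times> complex" where
  "chart p = (W1.well_map (first_pair p), W2.well_map (second_pair p))"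

lemma open_chart_domain: "open chart_domain"
proof -
  have "chart_domain = first_pair -` W1.well \<inter> second_pair -` W2.well"
    by (auto simp: chart_domain_def)
  then show ?thesis
    using bounded_linear_pairs[THEN linear_continuous_on] W1.open_well W2.open_well
    by (simp add: open_Int open_vimage)
qed

lemma smooth_on_chart: "smooth_on chart_domain chart"
  unfolding chart_def[abs_def]
  by (intro smooth_on_Pair smooth_on_compose[OF W1.smooth_on_well_map]
      smooth_on_compose[OF W2.smooth_on_well_map] smooth_on_bounded_linear bounded_linear_pairs
      open_chart_domain W1.open_well W2.open_well)
    (auto simp: chart_domain_def)

lemma inj_on_chart: "inj_on chart chart_domain"
proof (rule inj_onI)
  fix p q assume "p \<in> chart_domain" "q \<in> chart_domain" "chart p = chart q"
  then have "first_pair p = first_pair q" "second_pair p = second_pair q"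
    using W1.inj_on_well_map W2.inj_on_well_map
    by (auto simp: chart_domain_def chart_def dest: inj_onD)
  then show "p = q" by (metis join_pairs_simps(3))
qed

lemma symplectomorphism_chart:
  "symplectomorphism omega_cotangent chart_domain omega_C2 (chart ` chart_domain) chart"
proof (rule symplectomorphismI[OF open_chart_domain inj_on_chart smooth_on_chart])
  fix p v v' assume "p \<in> chart_domain"
  then have p: "first_pair p \<in> W1.well" "second_pair p \<in> W2.well" by (auto simp: chart_domain_def)
  note D1 = smooth_on_has_derivative[OF W1.smooth_on_well_map p(1)]
  note D2 = smooth_on_has_derivative[OF W2.smooth_on_well_map p(2)]
  let ?D1 = "frechet_derivative W1.well_map (at (first_pair p))"
  let ?D2 = "frechet_derivative W2.well_map (at (second_pair p))"
  have "(chart has_derivative (\<lambda>v. (?D1 (first_pair v), ?D2 (second_pair v)))) (at p)"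
    unfolding chart_def[abs_def]
    by (intro has_derivative_Pair has_derivative_compose[where f=first_pair, OF _ D1]
        has_derivative_compose[where f=second_pair, OF _ D2]
        bounded_linear_imp_has_derivative bounded_linear_pairs)
  from frechet_derivative_at[OF this, symmetric]
  show "omega_C2 (frechet_derivative chart (at p) v) (frechet_derivative chart (at p) v')
      = omega_cotangent v v'"
    by (simp add: omega_C2_eq_area_form omega_cotangent_pairs
        W1.area_form_well_map[OF p(1) D1] W2.area_form_well_map[OF p(2) D2])
qed

lemma chart_image: "chart ` inner_part = frontier stark_toric_domain"
proof (intro equalityI subsetI)
  fix u assume "u \<in> chart ` inner_part"
  then obtain p where u: "u = chart p" and p: "p \<in> hypersurface" "first_pair p \<in> W1.well"
    "second_pair p \<in> W2.well"
    by (auto simp: inner_part_eq chart_domain_def)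
  have e2: "W2.well_energy (second_pair p) = 2 - W1.well_energy (first_pair p)"
    using p(1) by (simp add: mem_hypersurface)
  have "W1.well_energy (first_pair p) \<in> {0..2}"
    using W1.well_energy_nonneg[OF p(2)] W2.well_energy_nonneg[OF p(3)] e2 by auto
  then show "u \<in> frontier stark_toric_domain"
    using W1.action_well_map[OF p(2)] W2.action_well_map[OF p(3)]
    by (auto simp: frontier_stark_toric_domain u chart_def e2)
next
  fix u assume "u \<in> frontier stark_toric_domain"
  then obtain u1 u2 e where u: "u = (u1, u2)" and e: "0 \<le> e" "e \<le> 2"
    and a: "pi * (cmod u1)\<^sup>2 = W1.action e" "pi * (cmod u2)\<^sup>2 = W2.action (2 - e)"
    by (auto simp: frontier_stark_toric_domain)
  obtain a1 where a1: "a1 \<in> W1.well" "W1.well_energy a1 = e" "W1.well_map a1 = u1"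
    using W1.well_map_surj[of e u1] e a two_less_max_energy by auto
  obtain a2 where a2: "a2 \<in> W2.well" "W2.well_energy a2 = 2 - e" "W2.well_map a2 = u2"
    using W2.well_map_surj[of "2 - e" u2] e a two_less_max_energy by auto
  have "join_pairs a1 a2 \<in> inner_part"
    using a1 a2 by (simp add: inner_part_eq mem_hypersurface chart_domain_def)
  moreover have "chart (join_pairs a1 a2) = u" using a1 a2 by (simp add: chart_def u)
  ultimately show "u \<in> chart ` inner_part" by blast
qed

end

theorem theorem1p1:
  fixes \<epsilon> h :: real
  assumes "\<epsilon> > 0" and "h < - 2 * sqrt \<epsilon>"
  shows "\<exists>X U V \<phi>.
    concave_toric_domain X \<and>
    symplectomorphism omega_cotangent U omega_C2 V \<phi> \<and>
    bounded_component \<epsilon> h \<subseteq> U \<and> frontier X \<subseteq> V \<and>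
    \<phi> ` bounded_component \<epsilon> h = frontier X"
proof -
  have c: "2 * sqrt \<epsilon> < - h" using assms(2) by simp
  have "0 < sqrt \<epsilon>" using assms(1) by simp
  then have pos: "0 < - h" using c by linarith
  have "(2 * sqrt \<epsilon>)\<^sup>2 < (- h)\<^sup>2" by (rule power2_strict_mono) (use c assms(1) pos in simp)
  then interpret stark_below_critical \<epsilon> "- h"
    using assms(1) pos by unfold_locales (simp_all add: power_mult_distrib)
  have B: "bounded_component \<epsilon> h = inner_part" using bounded_component_eq by simp
  have sub: "inner_part \<subseteq> chart_domain" by (auto simp: inner_part_eq)
  have "frontier stark_toric_domain \<subseteq> chart ` chart_domain"
    unfolding chart_image[symmetric] by (rule image_mono[OF sub])
  then show ?thesis
    unfolding B
    using concave_toric_domain_stark symplectomorphism_chart sub chart_image by blast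
qed

end
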